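(* Let $M^n\subset\mathbb{R}^{n+k}$ be a complete, properly immersed translating soliton, and let $S(X)=\langle X,W\rangle$ for $X\in M$. Fix $X_0\in M$. Then for every point $X\in M$, $$S(X)>\inf_M S=\liminf_{d(Y,X_0)\to\infty}S(Y),$$ where $d(Y,X_0)$ is the geodesic distance between $Y$ and $X_0$ on $M$.
   Context: Let $W\in\mathbb{R}^{n+k}$ be a fixed unit vector. For an immersed $n$-dimensional submanifold $M\subset\mathbb{R}^{n+k}$ with induced metric, a local orthonormal tangent frame $\{e_i\}$ and a local orthonormal normal frame $\{\nu_\alpha\}_{1\le\alpha\le k}$, put $h_{\alpha ij}=\langle D_{e_i}\nu_\alpha,e_j\rangle$ (with $D$ the directional derivative of $\mathbb{R}^{n+k}$) and $H_\alpha=\sum_j h_{\alpha jj}$; the mean curvature vector is $\vec H=-\sum_\alpha H_\alpha\nu_\alpha$. $M$ is a translating soliton (with respect to $W$) if $H_\alpha=\langle\nu_\alpha,W\rangle$ on $M$ for all $1\le\alpha\le k$. $X$ denotes the position vector. The infimum may be $-\infty$. *)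

theory Defs
  imports "HOL-Analysis.Analysis"
begin

primrec Ck_on :: "nat \<Rightarrow> 'a::euclidean_space set \<Rightarrow> ('a \<Rightarrow> 'b::real_normed_vector) \<Rightarrow> bool" where
  "Ck_on 0 U f \<longleftrightarrow> continuous_on U f"
| "Ck_on (Suc r) U f \<longleftrightarrow>
     (\<forall>x\<in>U. f differentiable (at x)) \<and>
     (\<forall>v. Ck_on r U (\<lambda>x. frechet_derivative f (at x) v))"

text \<open>Only used for open sets \<open>U\<close>, since derivatives are taken in the whole space.\<close>
definition smooth_on :: "'a::euclidean_space set \<Rightarrow> ('a \<Rightarrow> 'b::real_normed_vector) \<Rightarrow> bool" where
  "smooth_on U f \<longleftrightarrow> (\<forall>r. Ck_on r U f)"

text \<open>
  An atlas is given by its local parametrizations, i.e. by the inverses of its charts: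
  a pair \<open>(V, \<psi>)\<close> stands for the chart \<open>inv_into V \<psi>\<close>, defined on \<open>\<psi> ` V\<close>.
\<close>
type_synonym ('n, 'm) atlas = "((real^'n) set \<times> (real^'n \<Rightarrow> 'm)) set"

definition smooth_manifold :: "'m topology \<Rightarrow> ('n::finite, 'm) atlas \<Rightarrow> bool" where
  "smooth_manifold M A \<longleftrightarrow>
     Hausdorff_space M \<and> second_countable M \<and>
     (\<forall>(V, \<psi>)\<in>A. open V \<and> openin M (\<psi> ` V) \<and> embedding_map (top_of_set V) M \<psi>) \<and>
     (\<Union>(V, \<psi>)\<in>A. \<psi> ` V) = topspace M \<and>
     (\<forall>(V, \<psi>)\<in>A. \<forall>(V', \<psi>')\<in>A.
        smooth_on {x\<in>V. \<psi> x \<in> \<psi>' ` V'} (inv_into V' \<psi>' \<circ> \<psi>))"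

definition smooth_immersion :: "('n::finite, 'm) atlas \<Rightarrow> ('m \<Rightarrow> 'e::euclidean_space) \<Rightarrow> bool" where
  "smooth_immersion A F \<longleftrightarrow>
     (\<forall>(V, \<psi>)\<in>A. smooth_on V (F \<circ> \<psi>) \<and>
        (\<forall>x\<in>V. inj (frechet_derivative (F \<circ> \<psi>) (at x))))"

definition piecewise_C1_curve ::
    "'m topology \<Rightarrow> ('n::finite, 'm) atlas \<Rightarrow> (real \<Rightarrow> 'm) \<Rightarrow> bool" where
  "piecewise_C1_curve M A \<gamma> \<longleftrightarrow>
     pathin M \<gamma> \<and>
     (\<forall>(V, \<psi>)\<in>A. \<forall>a b. 0 \<le> a \<and> a \<le> b \<and> b \<le> 1 \<and> \<gamma> ` {a..b} \<subseteq> \<psi> ` V \<longrightarrow>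
        (inv_into V \<psi> \<circ> \<gamma>) piecewise_C1_differentiable_on {a..b})"

text \<open>
  In the metric induced by \<open>F\<close>, the speed of \<open>\<gamma>\<close> is the norm of \<open>(F \<circ> \<gamma>)'\<close>. The length is an
  extended real because piecewise \<open>C\<^sup>1\<close> functions, in the sense of the library, may have
  unbounded, even non-integrable, derivatives near the breakpoints.
\<close>
definition curve_length :: "('m \<Rightarrow> 'e::euclidean_space) \<Rightarrow> (real \<Rightarrow> 'm) \<Rightarrow> ennreal" where
  "curve_length F \<gamma> =
     (\<integral>\<^sup>+t\<in>{0..1}. ennreal (norm (vector_derivative (F \<circ> \<gamma>) (at t))) \<partial>lborel)"

text \<open>The infimum is finite if \<open>p\<close> and \<open>q\<close> lie in the same component of \<open>M\<close>.\<close>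
definition geodesic_dist ::
    "'m topology \<Rightarrow> ('n::finite, 'm) atlas \<Rightarrow> ('m \<Rightarrow> 'e::euclidean_space) \<Rightarrow> 'm \<Rightarrow> 'm \<Rightarrow> real" where
  "geodesic_dist M A F p q =
     enn2real (INF \<gamma>\<in>{\<gamma>. piecewise_C1_curve M A \<gamma> \<and> \<gamma> 0 = p \<and> \<gamma> 1 = q}. curve_length F \<gamma>)"

text \<open>
  Local orthonormal tangent and normal frames, written in the coordinates of a local
  parametrization \<open>f = F \<circ> \<psi>\<close>: the tangent frame at \<open>f x\<close> is \<open>e\<^sub>i = df\<^sub>x (v i x)\<close>,
  the normal frame is \<open>\<nu> \<alpha> x\<close>.
\<close>
definition adapted_frame ::
    "(real^'n \<Rightarrow> real^('n + 'k)) \<Rightarrow> (real^'n) set \<Rightarrow>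
     ('n::finite \<Rightarrow> real^'n \<Rightarrow> real^'n) \<Rightarrow> ('k::finite \<Rightarrow> real^'n \<Rightarrow> real^('n + 'k)) \<Rightarrow> bool" where
  "adapted_frame f U v \<nu> \<longleftrightarrow>
     (\<forall>i. smooth_on U (v i)) \<and> (\<forall>\<alpha>. smooth_on U (\<nu> \<alpha>)) \<and>
     (\<forall>x\<in>U.
        (\<forall>i j. frechet_derivative f (at x) (v i x) \<bullet> frechet_derivative f (at x) (v j x)
                 = (if i = j then 1 else 0)) \<and>
        (\<forall>\<alpha> \<beta>. \<nu> \<alpha> x \<bullet> \<nu> \<beta> x = (if \<alpha> = \<beta> then 1 else 0)) \<and>
        (\<forall>\<alpha> w. \<nu> \<alpha> x \<bullet> frechet_derivative f (at x) w = 0))"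

text \<open>
  \<open>h\<^sub>\<alpha>\<^sub>i\<^sub>j = \<langle>D\<^bsub>e\<^sub>i\<^esub> \<nu>\<^sub>\<alpha>, e\<^sub>j\<rangle>\<close>: in coordinates, differentiating along
  \<open>e\<^sub>i = df\<^sub>x (v i x)\<close> means differentiating in direction \<open>v i x\<close>.
\<close>
definition second_fund_form ::
    "(real^'n \<Rightarrow> real^('n + 'k)) \<Rightarrow>
     ('n::finite \<Rightarrow> real^'n \<Rightarrow> real^'n) \<Rightarrow> ('k::finite \<Rightarrow> real^'n \<Rightarrow> real^('n + 'k)) \<Rightarrow>
     'k \<Rightarrow> 'n \<Rightarrow> 'n \<Rightarrow> real^'n \<Rightarrow> real" where
  "second_fund_form f v \<nu> \<alpha> i j x =
     frechet_derivative (\<nu> \<alpha>) (at x) (v i x) \<bullet> frechet_derivative f (at x) (v j x)"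

definition mean_curv ::
    "(real^'n \<Rightarrow> real^('n + 'k)) \<Rightarrow>
     ('n::finite \<Rightarrow> real^'n \<Rightarrow> real^'n) \<Rightarrow> ('k::finite \<Rightarrow> real^'n \<Rightarrow> real^('n + 'k)) \<Rightarrow>
     'k \<Rightarrow> real^'n \<Rightarrow> real" where
  "mean_curv f v \<nu> \<alpha> x = (\<Sum>j\<in>UNIV. second_fund_form f v \<nu> \<alpha> j j x)"

definition translating_soliton ::
    "real^('n::finite + 'k::finite) \<Rightarrow> ('n, 'm) atlas \<Rightarrow> ('m \<Rightarrow> real^('n + 'k)) \<Rightarrow> bool" where
  "translating_soliton W A F \<longleftrightarrow>
     (\<forall>(V, \<psi>)\<in>A. \<forall>U v (\<nu> :: 'k \<Rightarrow> real^'n \<Rightarrow> real^('n + 'k)).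
        open U \<and> U \<subseteq> V \<and> adapted_frame (F \<circ> \<psi>) U v \<nu> \<longrightarrow>
        (\<forall>x\<in>U. \<forall>\<alpha>. mean_curv (F \<circ> \<psi>) v \<nu> \<alpha> x = \<nu> \<alpha> x \<bullet> W))"

end

theory Submission
  imports Defs
begin

text \<open>
  The height \<open>S = \<langle>X, W\<rangle>\<close> of a soliton satisfies \<open>\<Delta>S = -|W\<^sup>\<bottom>|\<^sup>2\<close>, where \<open>W\<^sup>\<bottom>\<close> is the normal
  part of \<open>W\<close>. At a local minimum \<open>W\<close> is normal, so \<open>\<Delta>S = -1\<close>, contradicting the second derivative
  test; hence \<open>S\<close> has no local minimum. The length of a curve dominates the Euclidean distance of its
  endpoints, so by properness every geodesic ball lies in a compact set. On such a set \<open>S\<close> attains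
  its minimum, which exceeds \<open>inf S\<close>, so the infimum is only approached at infinity.
\<close>

subsection \<open>Calculus of smooth maps\<close>

text \<open>The soliton hypothesis is an equation for every adapted frame, so it says nothing at a
  point until a smooth frame near that point has been produced; this is why a Gram-Schmidt process
  for smooth fields, and with it some calculus of \<open>smooth_on\<close>, comes before any
  geometry. No Laplacian is ever defined: at a critical point of the height the second derivative in
  chart coordinates, traced over the tangent frame, already takes its place. On the global side,
  \<open>geodesic_dist\<close> is \<open>enn2real\<close> of an infimum and would collapse to 0 if
  that infimum were infinite, which would destroy the comparison with the Euclidean distance.
  Connectedness must therefore be turned into curves of finite length between any two points. The
  converse estimate, length against chord, has to cope with curves whose derivative is unbounded
  near breakpoints, so it passes through the gauge integral.\<close>

lemma Ck_on_cong:
  assumes "open U" "\<And>x. x \<in> U \<Longrightarrow> f x = g x" "Ck_on r U f"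
  shows "Ck_on r U g"
  using assms
proof (induction r arbitrary: f g)
  case 0
  then show ?case
    using continuous_on_cong[of U U f g] by simp
next
  case (Suc r)
  have iff: "(f has_derivative D) (at x) \<longleftrightarrow> (g has_derivative D) (at x)" if "x \<in> U" for x D
    using has_derivative_transform_within_open[of f D x UNIV U g]
      has_derivative_transform_within_open[of g D x UNIV U f] Suc.prems(1,2) that by auto
  then have "frechet_derivative f (at x) = frechet_derivative g (at x)" if "x \<in> U" for x
    using that by (simp add: frechet_derivative_def)
  then have "Ck_on r U (\<lambda>x. frechet_derivative g (at x) v)" for v
    using Suc.prems Suc.IH[of "\<lambda>x. frechet_derivative f (at x) v"] by simp
  moreover have "g differentiable (at x)" if "x \<in> U" for x
    using Suc.prems(3) iff that by (auto simp: differentiable_def)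
  ultimately show ?case by simp
qed

text \<open>Since \<open>frechet_derivative\<close> is a choice operator, \<open>Ck_on\<close>
  cannot be computed with directly. Uniqueness of derivatives and \<open>Ck_on_cong\<close> let an
  explicit formula \<open>f'\<close> stand in for it.\<close>

lemma Ck_on_SucI:
  assumes "open U" "\<And>x. x \<in> U \<Longrightarrow> (f has_derivative f' x) (at x)"
    and "\<And>v. Ck_on r U (\<lambda>x. f' x v)"
  shows "Ck_on (Suc r) U f"
proof -
  have "Ck_on r U (\<lambda>x. frechet_derivative f (at x) v)" for v
    using assms frechet_derivative_at[OF assms(2)] by (intro Ck_on_cong[OF assms(1) _ assms(3)]) simp
  then show ?thesis
    using assms(2) by (auto simp: differentiable_def)
qed

lemma Ck_on_SucD:
  assumes "Ck_on (Suc r) U f" "x \<in> U"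
  shows "(f has_derivative frechet_derivative f (at x)) (at x)"
  using assms frechet_derivative_works by auto

text \<open>Serves the product rule, where the factor that is left undifferentiated has to be
  weakened by one order before the induction hypothesis applies.\<close>

lemma Ck_on_Suc_imp: "Ck_on (Suc r) U f \<Longrightarrow> Ck_on r U f"
proof (induction r arbitrary: f)
  case 0
  then show ?case
    by (auto intro!: continuous_at_imp_continuous_on differentiable_imp_continuous_within)
next
  case (Suc r)
  then show ?case by auto
qed

lemma Ck_on_subset: "Ck_on r U f \<Longrightarrow> T \<subseteq> U \<Longrightarrow> Ck_on r T f"
  by (induction r arbitrary: f) (auto intro: continuous_on_subset)

lemma Ck_on_const: "Ck_on r U (\<lambda>x. c)"
  by (induction r arbitrary: c) auto

lemma Ck_on_add:
  assumes "open U" "Ck_on r U f" "Ck_on r U g"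
  shows "Ck_on r U (\<lambda>x. f x + g x)"
  using assms
proof (induction r arbitrary: f g)
  case 0
  then show ?case by (auto intro: continuous_intros)
next
  case (Suc r)
  show ?case
  proof (rule Ck_on_SucI[OF \<open>open U\<close>])
    show "((\<lambda>x. f x + g x) has_derivative
        (\<lambda>v. frechet_derivative f (at x) v + frechet_derivative g (at x) v)) (at x)" if "x \<in> U" for x
      using Ck_on_SucD[OF Suc.prems(2) that] Ck_on_SucD[OF Suc.prems(3) that] by (intro has_derivative_add)
    show "Ck_on r U (\<lambda>x. frechet_derivative f (at x) v + frechet_derivative g (at x) v)" for v
      using Suc.prems by (intro Suc.IH) auto
  qed
qed

lemma (in bounded_bilinear) Ck_on:
  assumes "open U" "Ck_on r U f" "Ck_on r U g"
  shows "Ck_on r U (\<lambda>x. prod (f x) (g x))"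
  using assms
proof (induction r arbitrary: f g)
  case 0
  then show ?case by (auto intro: continuous_on)
next
  case (Suc r)
  show ?case
  proof (rule Ck_on_SucI[OF \<open>open U\<close>])
    show "((\<lambda>x. prod (f x) (g x)) has_derivative
        (\<lambda>v. prod (f x) (frechet_derivative g (at x) v) + prod (frechet_derivative f (at x) v) (g x))) (at x)"
      if "x \<in> U" for x
      using Ck_on_SucD[OF Suc.prems(2) that] Ck_on_SucD[OF Suc.prems(3) that] by (intro FDERIV)
    show "Ck_on r U (\<lambda>x. prod (f x) (frechet_derivative g (at x) v) + prod (frechet_derivative f (at x) v) (g x))" for v
      using Suc.prems Ck_on_Suc_imp[OF Suc.prems(2)] Ck_on_Suc_imp[OF Suc.prems(3)]
      by (intro Ck_on_add Suc.IH) auto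
  qed
qed

lemma smooth_on_cong:
  "open U \<Longrightarrow> (\<And>x. x \<in> U \<Longrightarrow> f x = g x) \<Longrightarrow> smooth_on U f \<Longrightarrow> smooth_on U g"
  using Ck_on_cong unfolding smooth_on_def by blast

lemma smooth_on_subset: "smooth_on U f \<Longrightarrow> T \<subseteq> U \<Longrightarrow> smooth_on T f"
  using Ck_on_subset unfolding smooth_on_def by blast

lemma smooth_on_const: "smooth_on U (\<lambda>x. c)"
  by (simp add: smooth_on_def Ck_on_const)

lemma smooth_on_add:
  "open U \<Longrightarrow> smooth_on U f \<Longrightarrow> smooth_on U g \<Longrightarrow> smooth_on U (\<lambda>x. f x + g x)"
  by (simp add: smooth_on_def Ck_on_add)

lemma smooth_on_sum:
  assumes "open U" "\<And>i. i \<in> I \<Longrightarrow> smooth_on U (f i)"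
  shows "smooth_on U (\<lambda>x. \<Sum>i\<in>I. f i x)"
  using assms(2)
  by (induction I rule: infinite_finite_induct)
     (auto intro: smooth_on_const smooth_on_add[OF assms(1)])

lemma (in bounded_bilinear) smooth_on:
  "open U \<Longrightarrow> smooth_on U f \<Longrightarrow> smooth_on U g \<Longrightarrow> smooth_on U (\<lambda>x. prod (f x) (g x))"
  by (simp add: smooth_on_def Ck_on)

lemmas smooth_on_scaleR = bounded_bilinear.smooth_on[OF bounded_bilinear_scaleR]
  and smooth_on_inner = bounded_bilinear.smooth_on[OF bounded_bilinear_inner]

lemma smooth_on_diff:
  assumes "open U" "smooth_on U f" "smooth_on U g"
  shows "smooth_on U (\<lambda>x. f x - g x)"
  using smooth_on_add[OF assms(1,2) smooth_on_scaleR[OF assms(1) smooth_on_const[of U "-1"] assms(3)]]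
  by simp

text \<open>The function h = f^(-1/2) satisfies h' = -1/2 h^3 f'. Its derivative is a polynomial in
  h and f', so induction on the order closes with the product rule alone. This provides the
  normalizing factors of Gram-Schmidt.\<close>

lemma smooth_on_inverse_sqrt:
  fixes f :: "'a::euclidean_space \<Rightarrow> real"
  assumes "open U" "smooth_on U f" "\<And>x. x \<in> U \<Longrightarrow> f x > 0"
  shows "smooth_on U (\<lambda>x. inverse (sqrt (f x)))"
proof -
  note mult = bounded_bilinear.Ck_on[OF bounded_bilinear_mult \<open>open U\<close>]
  have "Ck_on r U (\<lambda>x. inverse (sqrt (f x)))" for r
  proof (induction r)
    case 0
    have "continuous_on U f"
      using assms(2) by (metis Ck_on.simps(1) smooth_on_def)
    moreover have "sqrt (f x) \<noteq> 0" if "x \<in> U" for x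
      using assms(3)[OF that] by simp
    ultimately show ?case
      unfolding Ck_on.simps by (intro continuous_on_inverse continuous_on_real_sqrt ballI)
  next
    case (Suc r)
    have f: "Ck_on (Suc r) U f"
      using assms(2) by (simp add: smooth_on_def)
    let ?h = "\<lambda>x. inverse (sqrt (f x))"
    show ?case
    proof (rule Ck_on_SucI[OF \<open>open U\<close>])
      fix x assume x: "x \<in> U"
      have "f x > 0" using assms(3) x by simp
      then have "((\<lambda>t. inverse (sqrt t)) has_real_derivative (-1/2 * (?h x * (?h x * ?h x)))) (at (f x))"
        using DERIV_inverse'[OF DERIV_real_sqrt[of "f x"]] by (simp add: mult.commute)
      then have "((\<lambda>t. inverse (sqrt t)) has_derivative (\<lambda>t. (-1/2 * (?h x * (?h x * ?h x))) * t)) (at (f x))"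
        unfolding has_field_derivative_def .
      from has_derivative_compose[OF Ck_on_SucD[OF f x] this]
      show "(?h has_derivative (\<lambda>v. (-1/2 * (?h x * (?h x * ?h x))) * frechet_derivative f (at x) v)) (at x)" .
    next
      show "Ck_on r U (\<lambda>x. (-1/2 * (?h x * (?h x * ?h x))) * frechet_derivative f (at x) v)" for v
        using f by (intro mult Suc.IH Ck_on_const) simp
    qed
  qed
  then show ?thesis by (simp add: smooth_on_def)
qed

lemma smooth_on_imp_continuous_on: "smooth_on U f \<Longrightarrow> continuous_on U f"
  by (metis Ck_on.simps(1) smooth_on_def)

lemma smooth_on_has_derivative:
  "smooth_on U f \<Longrightarrow> x \<in> U \<Longrightarrow> (f has_derivative frechet_derivative f (at x)) (at x)"
  by (metis Ck_on_SucD smooth_on_def)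

lemma smooth_on_frechet_derivative:
  "smooth_on U f \<Longrightarrow> smooth_on U (\<lambda>x. frechet_derivative f (at x) v)"
  by (metis Ck_on.simps(2) smooth_on_def)

text \<open>Expanding \<open>w y\<close> in the fixed standard basis turns the expression into a
  finite sum of products of smooth functions. It allows moving vectors to be inserted into families
  known to be smooth only on constant ones.\<close>

lemma smooth_on_linear_family_apply:
  fixes T :: "'a::euclidean_space \<Rightarrow> 'b::euclidean_space \<Rightarrow> 'c::real_normed_vector"
  assumes "open U" "\<And>y. y \<in> U \<Longrightarrow> linear (T y)"
    and "\<And>u. smooth_on U (\<lambda>y. T y u)" "smooth_on U w"
  shows "smooth_on U (\<lambda>y. T y (w y))"
proof (rule smooth_on_cong[OF \<open>open U\<close>])
  show "smooth_on U (\<lambda>y. \<Sum>b\<in>Basis. (w y \<bullet> b) *\<^sub>R T y b)"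
    using assms by (intro smooth_on_sum smooth_on_scaleR smooth_on_inner smooth_on_const)
  show "(\<Sum>b\<in>Basis. (w y \<bullet> b) *\<^sub>R T y b) = T y (w y)" if "y \<in> U" for y
  proof -
    interpret linear "T y" using assms(2) that .
    show ?thesis by (simp flip: scale sum add: euclidean_representation)
  qed
qed

subsection \<open>Adapted frames\<close>

text \<open>The fields live in the source of \<open>T y\<close>, and orthonormality is measured in
  the pullback of the inner product. With the differential for \<open>T\<close> this describes
  tangent frames, with the projection onto the normal spaces it describes normal frames.\<close>

definition orthonormal_fields where
  "orthonormal_fields T I U v \<longleftrightarrow> (\<forall>i\<in>I. smooth_on U (v i)) \<and>
     (\<forall>y\<in>U. \<forall>i\<in>I. \<forall>j\<in>I. T y (v i y) \<bullet> T y (v j y) = (if i = j then 1 else 0))"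

text \<open>Gram-Schmidt for the pullback form of \<open>T y\<close>, started from the constant
  fields \<open>g\<close>. Nondegeneracy is known only at \<open>x\<close>; continuity extends it to
  a neighbourhood that shrinks with every new vector.\<close>

lemma gram_schmidt_fields:
  fixes T :: "'a::euclidean_space \<Rightarrow> 'b::euclidean_space \<Rightarrow> 'c::euclidean_space" and g :: "'i \<Rightarrow> 'b"
  assumes "finite I" "open U" "x \<in> U" "\<And>y. y \<in> U \<Longrightarrow> linear (T y)"
    and "\<And>u. smooth_on U (\<lambda>y. T y u)"
    and "inj_on g I" "independent (g ` I)"
    and "\<And>w. w \<in> span (g ` I) \<Longrightarrow> T x w = 0 \<Longrightarrow> w = 0"
  obtains U' v where "open U'" "x \<in> U'" "U' \<subseteq> U" "orthonormal_fields T I U' v"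
proof -
  \<comment> \<open>The span clause strengthens the induction: it makes the next residual nonzero at
    \<open>x\<close> and places it where the kernel hypothesis on \<open>T x\<close>
    applies.\<close>
  define P where "P I U' v \<longleftrightarrow> open U' \<and> x \<in> U' \<and> U' \<subseteq> U \<and> (\<forall>i\<in>I. smooth_on U' (v i)) \<and>
    (\<forall>i\<in>I. \<forall>y\<in>U'. v i y \<in> span (g ` I)) \<and>
    (\<forall>i\<in>I. \<forall>j\<in>I. \<forall>y\<in>U'. T y (v i y) \<bullet> T y (v j y) = (if i = j then 1 else 0))" for I U' v
  have "\<exists>U' v. P I U' v"
    using assms(1,6-8)
  proof (induction I)
    case empty
    have "P {} U v" for v using assms(2,3) by (simp add: P_def)
    then show ?case by blast
  next
    case (insert a I)
    have sub: "span (g ` I) \<subseteq> span (g ` insert a I)"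
      by (intro span_mono) auto
    have ga: "g a \<notin> g ` I" and ind: "independent (g ` I)"
      using insert.prems(1,2) insert.hyps(2) independent_mono[OF insert.prems(2)] by auto
    then have ga': "g a \<notin> span (g ` I)"
      using insert.prems(2) by (auto simp: independent_insert)
    have "inj_on g I" using insert.prems(1) by simp
    have "w = 0" if "w \<in> span (g ` I)" "T x w = 0" for w
      using insert.prems(3) sub that by blast
    from insert.IH[OF \<open>inj_on g I\<close> ind this]
    obtain U1 v where "P I U1 v"
      by blast
    then have U1: "open U1" "x \<in> U1" "U1 \<subseteq> U"
      and sm: "\<And>i. i \<in> I \<Longrightarrow> smooth_on U1 (v i)"
      and sp: "\<And>i y. i \<in> I \<Longrightarrow> y \<in> U1 \<Longrightarrow> v i y \<in> span (g ` I)"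
      and on: "\<And>i j y. i \<in> I \<Longrightarrow> j \<in> I \<Longrightarrow> y \<in> U1 \<Longrightarrow>
            T y (v i y) \<bullet> T y (v j y) = (if i = j then 1 else 0)"
      unfolding P_def by blast+
    have lin: "linear (T y)" if "y \<in> U1" for y using assms(4) U1 that by auto
    have smT: "smooth_on U1 (\<lambda>y. T y u)" for u
      using assms(5) U1(3) smooth_on_subset by blast
    define u where "u y = g a - (\<Sum>i\<in>I. (T y (g a) \<bullet> T y (v i y)) *\<^sub>R v i y)" for y
    have smTv: "smooth_on U1 (\<lambda>y. T y (v i y))" if "i \<in> I" for i
      using smooth_on_linear_family_apply[OF U1(1) lin smT sm[OF that]] by blast
    have smu: "smooth_on U1 u"
      unfolding u_def
      by (intro smooth_on_diff smooth_on_sum smooth_on_scaleR smooth_on_inner smooth_on_const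
          smT smTv sm U1)
    have smTu: "smooth_on U1 (\<lambda>y. T y (u y))"
      using smooth_on_linear_family_apply[OF U1(1) lin smT smu] by blast
    have uspan: "u y \<in> span (g ` insert a I)" if "y \<in> U1" for y
      unfolding u_def
      by (intro span_diff span_sum span_scale subsetD[OF sub sp] that) (auto intro: span_base)
    have "u x \<noteq> 0"
    proof
      assume "u x = 0"
      then have "g a = (\<Sum>i\<in>I. (T x (g a) \<bullet> T x (v i x)) *\<^sub>R v i x)"
        by (simp add: u_def)
      also have "\<dots> \<in> span (g ` I)"
        by (intro span_sum span_scale sp U1)
      finally show False using ga' by simp
    qed
    then have Tux: "T x (u x) \<noteq> 0"
      using insert.prems(3)[of "u x"] uspan U1(2) by blast
    \<comment> \<open>The residual is known to have nonzero image only at \<open>x\<close>;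
      \<open>U2\<close> is the open set on which it can be normalized.\<close>
    define U2 where "U2 = U1 \<inter> (\<lambda>y. T y (u y)) -` (- {0})"
    have "open U2"
      unfolding U2_def
      by (intro continuous_open_preimage smooth_on_imp_continuous_on smTu U1) auto
    have U2: "open U2" "x \<in> U2" "U2 \<subseteq> U1" "\<And>y. y \<in> U2 \<Longrightarrow> T y (u y) \<noteq> 0"
      using \<open>open U2\<close> Tux U1(2) by (auto simp: U2_def)
    define c where "c y = inverse (sqrt (T y (u y) \<bullet> T y (u y)))" for y
    have smc: "smooth_on U2 c"
      unfolding c_def using U2 smTu
      by (intro smooth_on_inverse_sqrt smooth_on_inner) (auto intro: smooth_on_subset)
    define v' where "v' i = (if i = a then (\<lambda>y. c y *\<^sub>R u y) else v i)" for i
    have orth: "T y (u y) \<bullet> T y (v j y) = 0" if "y \<in> U1" "j \<in> I" for y j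
    proof -
      interpret Ty: linear "T y" using lin that by blast
      have "T y (u y) = T y (g a) - (\<Sum>i\<in>I. (T y (g a) \<bullet> T y (v i y)) *\<^sub>R T y (v i y))"
        by (simp add: u_def Ty.diff Ty.sum Ty.scale)
      then have "T y (u y) \<bullet> T y (v j y)
          = T y (g a) \<bullet> T y (v j y) - (\<Sum>i\<in>I. (T y (g a) \<bullet> T y (v i y)) * (if i = j then 1 else 0))"
        using on that by (simp add: inner_diff_left inner_sum_left)
      also have "\<dots> = 0"
        using that insert.hyps by (simp add: if_distrib[of "\<lambda>t. _ * t"] cong: if_cong)
      finally show ?thesis .
    qed
    have one: "T y (c y *\<^sub>R u y) \<bullet> T y (c y *\<^sub>R u y) = 1" if "y \<in> U2" for y
    proof -
      have "linear (T y)" using lin that U2 by blast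
      then have "T y (c y *\<^sub>R u y) \<bullet> T y (c y *\<^sub>R u y) = (c y)\<^sup>2 * (T y (u y) \<bullet> T y (u y))"
        by (simp add: linear_scale power2_eq_square)
      moreover have "(c y)\<^sup>2 = inverse (T y (u y) \<bullet> T y (u y))"
        by (simp add: c_def power_inverse)
      ultimately show ?thesis
        using U2(4)[OF that] by simp
    qed
    have "P (insert a I) U2 v'"
      unfolding P_def
    proof (intro conjI ballI)
      fix i assume i: "i \<in> insert a I"
      show "smooth_on U2 (v' i)"
        using i U2 smc smooth_on_subset[OF smu U2(3)] smooth_on_subset[OF sm U2(3)]
        by (auto simp: v'_def intro!: smooth_on_scaleR)
      fix y assume y: "y \<in> U2"
      show "v' i y \<in> span (g ` insert a I)"
      proof (cases "i = a")
        case True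
        then show ?thesis
          using uspan y U2(3) by (auto simp del: image_insert simp: v'_def intro!: span_scale)
      next
        case False
        then show ?thesis
          using i sp[of i y] y U2(3) sub by (auto simp del: image_insert simp: v'_def)
      qed
    next
      fix i j y assume ij: "i \<in> insert a I" "j \<in> insert a I" and y: "y \<in> U2"
      have "y \<in> U1" using y U2 by auto
      then have "linear (T y)" by (rule lin)
      then have s: "T y (c y *\<^sub>R u y) = c y *\<^sub>R T y (u y)"
        by (simp add: linear_scale)
      consider "i = a" "j = a" | "i = a" "j \<in> I" "j \<noteq> a" | "i \<in> I" "j = a" "i \<noteq> a"
        | "i \<in> I" "j \<in> I" "i \<noteq> a" "j \<noteq> a"
        using ij insert.hyps(2) by blast
      then show "T y (v' i y) \<bullet> T y (v' j y) = (if i = j then 1 else 0)"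
      proof cases
        case 1
        then show ?thesis using one[OF y] by (simp add: v'_def)
      next
        case 2
        then show ?thesis using orth[OF \<open>y \<in> U1\<close>] by (simp add: v'_def s)
      next
        case 3
        then show ?thesis
          using orth[OF \<open>y \<in> U1\<close>] by (simp add: v'_def s inner_commute[of _ "T y (u y)"])
      next
        case 4
        then show ?thesis using on[OF _ _ \<open>y \<in> U1\<close>] by (simp add: v'_def)
      qed
    qed (use U2 U1 in auto)
    then show ?case by blast
  qed
  then obtain U' v where "P I U' v" by blast
  then show ?thesis unfolding P_def orthonormal_fields_def by (intro that[of U' v]) (simp_all add: orthonormal_fields_def)
qed

text \<open>Pairing with \<open>T (e j)\<close> recovers the coefficients of a combination of the
  \<open>e i\<close>, so the coefficient map \<open>L\<close> is injective, hence surjective between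
  spaces of equal dimension. Every \<open>w\<close> is thus a combination of the \<open>e i\<close>,
  with the coefficients just read off.\<close>

lemma orthonormal_expansion:
  fixes T :: "real^'m \<Rightarrow> 'c::euclidean_space" and e :: "'m::finite \<Rightarrow> real^'m"
  assumes "linear T" "\<And>i j. T (e i) \<bullet> T (e j) = (if i = j then 1 else 0)"
  shows "(\<Sum>i\<in>UNIV. (T (e i) \<bullet> T w) *\<^sub>R e i) = w"
proof -
  interpret T: linear T by fact
  define L :: "real^'m \<Rightarrow> real^'m" where "L c = (\<Sum>i\<in>UNIV. (c $ i) *\<^sub>R e i)" for c
  have L: "linear L"
    unfolding L_def by (auto intro!: linearI simp: scaleR_left_distrib sum.distrib scaleR_sum_right)
  have coeff: "T (e j) \<bullet> T (L c) = c $ j" for c j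
    by (simp add: L_def T.sum T.scale inner_sum_right assms(2) if_distrib[of "\<lambda>t. _ * t"] cong: if_cong)
  have "inj L"
  proof (rule injI)
    fix c d assume eq: "L c = L d"
    have "c $ j = d $ j" for j
      using coeff[of j c] coeff[of j d] unfolding eq by simp
    then show "c = d" by (simp add: vec_eq_iff)
  qed
  then have "surj L" using L linear_injective_imp_surjective by blast
  then obtain c where "w = L c" by blast
  then show ?thesis by (simp add: coeff) (simp add: L_def)
qed

text \<open>Gram-Schmidt runs twice, each time from constant vectors that are good at
  \<open>x\<close> only. The coordinate axes give the tangent frame because the differential at
  \<open>x\<close> is injective; a basis of the normal space at \<open>x\<close>, projected onto the
  nearby normal spaces, gives the normal frame.\<close>

lemma adapted_frame_exists:
  fixes f :: "real^'n::finite \<Rightarrow> real^('n + 'k::finite)"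
  assumes "open V" "smooth_on V f" "x \<in> V" "inj (frechet_derivative f (at x))"
  obtains U v and \<nu> :: "'k \<Rightarrow> real^'n \<Rightarrow> real^('n + 'k)"
    where "open U" "x \<in> U" "U \<subseteq> V" "adapted_frame f U v \<nu>"
proof -
  define D where "D y = frechet_derivative f (at y)" for y
  have lin: "linear (D y)" if "y \<in> V" for y
    unfolding D_def using smooth_on_has_derivative[OF assms(2) that] by (rule has_derivative_linear)
  have smD: "smooth_on V (\<lambda>y. D y u)" for u
    unfolding D_def using smooth_on_frechet_derivative[OF assms(2)] .
  have inj_axis: "inj_on (\<lambda>i. axis i 1 :: real^'n) UNIV"
    by (auto simp: inj_on_def axis_eq_axis)
  have "range (\<lambda>i. axis i 1 :: real^'n) \<subseteq> Basis"
    by (auto simp: Basis_vec_def)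
  then have ind_axis: "independent (range (\<lambda>i. axis i 1 :: real^'n))"
    using independent_mono independent_Basis by blast
  have ker: "w = 0" if "w \<in> span (range (\<lambda>i. axis i 1))" "D x w = 0" for w
    using that(2) assms(4) linear_0[OF lin[OF assms(3)]] unfolding D_def inj_def by metis
  obtain U1 v where U1: "open U1" "x \<in> U1" "U1 \<subseteq> V"
    and "orthonormal_fields D (UNIV :: 'n set) U1 v"
    using gram_schmidt_fields[OF finite_class.finite_UNIV assms(1,3) lin smD inj_axis ind_axis ker]
    by blast
  then have smv: "smooth_on U1 (v i)"
    and on: "y \<in> U1 \<Longrightarrow> D y (v i y) \<bullet> D y (v j y) = (if i = j then 1 else 0)" for i j y
    by (simp_all add: orthonormal_fields_def)
  define E where "E i y = D y (v i y)" for i y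
  have smE: "smooth_on U1 (E i)" for i
    unfolding E_def
    using smooth_on_linear_family_apply[OF U1(1) lin smooth_on_subset[OF smD U1(3)] smv] U1(3) by blast
  \<comment> \<open>The image of the differential is spanned by the fields \<open>E i\<close>, so
    being normal reduces to being orthogonal to these finitely many vectors.\<close>
  have span_E: "D y w = (\<Sum>i\<in>UNIV. (E i y \<bullet> D y w) *\<^sub>R E i y)" if "y \<in> U1" for y w
  proof -
    interpret Dy: linear "D y" using lin that U1(3) by blast
    have "D y w = D y (\<Sum>i\<in>UNIV. (D y (v i y) \<bullet> D y w) *\<^sub>R v i y)"
      using orthonormal_expansion[of "D y" "\<lambda>i. v i y" w] on[OF that] Dy.linear_axioms by simp
    then show ?thesis by (simp add: E_def Dy.sum Dy.scale)
  qed
  define N where "N = {w. \<forall>z\<in>range (D x). orthogonal z w}"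
  have "subspace (range (D x))"
    using lin[OF assms(3)] by (metis linear_subspace_image subspace_UNIV)
  from dim_subspace_orthogonal_to_vectors[OF this subspace_UNIV]
  have "dim N + dim (range (D x)) = CARD('n) + CARD('k)"
    by (simp add: N_def)
  moreover have "dim (range (D x)) = CARD('n)"
    using dim_image_eq[OF lin[OF assms(3)], of UNIV] assms(4) by (simp add: D_def)
  ultimately have dimN: "dim N = CARD('k)" by simp
  have "subspace N"
    unfolding N_def using subspace_orthogonal_to_vectors[of "range (D x)"] by (simp add: orthogonal_commute)
  then obtain B where B: "B \<subseteq> N" "pairwise orthogonal B" "\<And>b. b \<in> B \<Longrightarrow> norm b = 1"
      "independent B" "card B = dim N" "span B = N"
    using orthonormal_basis_subspace by metis
  have "finite B" using B(4) by (rule independent_imp_finite)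
  moreover have "card (UNIV :: 'k set) = card B"
    using B(5) dimN by simp
  ultimately obtain c where c: "bij_betw c (UNIV :: 'k set) B"
    using finite_same_card_bij[of "UNIV :: 'k set" B] by auto
  have inj_c: "inj_on c UNIV" and im_c: "range c = B"
    using c by (auto simp: bij_betw_def)
  \<comment> \<open>On \<open>U1\<close> the \<open>E i y\<close> are orthonormal, so
    \<open>T y\<close> is the orthogonal projection onto the normal space at \<open>y\<close>. At
    \<open>x\<close> it fixes \<open>N\<close>, which gives the trivial kernel on the span of
    \<open>B\<close> that Gram-Schmidt asks for.\<close>
  define T where "T y u = u - (\<Sum>i\<in>UNIV. (u \<bullet> E i y) *\<^sub>R E i y)" for y u
  have linT: "linear (T y)" for y
    unfolding T_def
    by (auto intro!: linearI simp: inner_add_left scaleR_left_distrib sum.distrib scaleR_sum_right scaleR_diff_right)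
  have smT: "smooth_on U1 (\<lambda>y. T y u)" for u
    unfolding T_def
    by (intro smooth_on_diff smooth_on_sum smooth_on_scaleR smooth_on_inner smooth_on_const smE U1)
  have T_id: "T x w = w" if "w \<in> N" for w
  proof -
    have "w \<bullet> E i x = 0" for i
      using that by (simp add: N_def E_def orthogonal_def inner_commute)
    then show ?thesis by (simp add: T_def)
  qed
  have T_orth: "T y u \<bullet> E j y = 0" if "y \<in> U1" for y u j
    using on[OF that]
    by (simp add: T_def E_def inner_diff_left inner_sum_left if_distrib[of "\<lambda>t. _ * t"] cong: if_cong)
  have kerT: "w = 0" if "w \<in> span (range c)" "T x w = 0" for w
    using that T_id B(6) im_c by simp
  have ind_c: "independent (range c)" using B(4) im_c by simp
  obtain U2 u where U2: "open U2" "x \<in> U2" "U2 \<subseteq> U1"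
    and "orthonormal_fields T (UNIV :: 'k set) U2 u"
    using gram_schmidt_fields[OF finite_class.finite_UNIV U1(1,2) linT smT inj_c ind_c kerT]
    by blast
  then have smu: "smooth_on U2 (u \<alpha>)"
    and on\<nu>: "y \<in> U2 \<Longrightarrow> T y (u \<alpha> y) \<bullet> T y (u \<beta> y) = (if \<alpha> = \<beta> then 1 else 0)" for \<alpha> \<beta> y
    by (simp_all add: orthonormal_fields_def)
  define \<nu> where "\<nu> \<alpha> y = T y (u \<alpha> y)" for \<alpha> y
  have sm\<nu>: "smooth_on U2 (\<nu> \<alpha>)" for \<alpha>
    unfolding \<nu>_def
    using smooth_on_linear_family_apply[OF U2(1) linT smooth_on_subset[OF smT U2(3)] smu] by blast
  have "\<nu> \<alpha> y \<bullet> D y w = 0" if "y \<in> U2" for \<alpha> y w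
  proof -
    have y: "y \<in> U1" using that U2 by blast
    show ?thesis
      by (subst span_E[OF y]) (simp add: inner_sum_right \<nu>_def T_orth[OF y])
  qed
  moreover have "smooth_on U2 (v i)" for i
    using smooth_on_subset[OF smv U2(3)] .
  ultimately have "adapted_frame f U2 v \<nu>"
    unfolding adapted_frame_def using sm\<nu> on U2(3) on\<nu> by (auto simp: D_def \<nu>_def)
  then show ?thesis using that[of U2 v \<nu>] U2 U1(3) by blast
qed

text \<open>Tangent and normal frame together form an orthonormal family indexed by the sum type
  \<open>'n + 'k\<close>, which is also the index type of the ambient space. It is therefore a
  basis, and the tangential coefficients of \<open>W\<close> vanish.\<close>

lemma adapted_frame_normal_expansion:
  fixes f :: "real^'n::finite \<Rightarrow> real^('n + 'k::finite)" and \<nu> :: "'k \<Rightarrow> real^'n \<Rightarrow> real^('n + 'k)"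
  assumes "adapted_frame f U v \<nu>" "x \<in> U" "\<And>w. frechet_derivative f (at x) w \<bullet> W = 0"
  shows "(\<Sum>\<alpha>\<in>UNIV. (\<nu> \<alpha> x \<bullet> W) *\<^sub>R \<nu> \<alpha> x) = W"
proof -
  define e where "e = case_sum (\<lambda>i. frechet_derivative f (at x) (v i x)) (\<lambda>\<alpha>. \<nu> \<alpha> x)"
  have "e i \<bullet> e j = (if i = j then 1 else 0)" for i j
    using assms(1,2) unfolding adapted_frame_def e_def
    by (cases i; cases j) (auto simp: inner_commute[of "frechet_derivative _ _ _" "\<nu> _ x"])
  then have "(\<Sum>i\<in>UNIV. (e i \<bullet> W) *\<^sub>R e i) = W"
    using orthonormal_expansion[OF linear_id, of e W] by simp
  then show ?thesis
    using assms(3)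
    by (simp add: sum.Plus e_def flip: UNIV_Plus_UNIV)
qed

subsection \<open>Absence of local minima of the height\<close>

text \<open>The second derivative is available at \<open>x\<close> only, so a Taylor formula is
  avoided. If \<open>L w\<close> were negative, the derivative along \<open>w\<close>, zero at
  \<open>x\<close>, would be negative just after \<open>x\<close>, and the mean value theorem would
  produce a smaller value.\<close>

lemma second_derivative_nonneg_at_min:
  fixes \<phi> :: "'a::real_normed_vector \<Rightarrow> real"
  assumes "open V" "x \<in> V" "\<And>y. y \<in> V \<Longrightarrow> (\<phi> has_derivative \<phi>' y) (at y)"
    and "((\<lambda>y. \<phi>' y w) has_derivative L) (at x)"
    and min: "\<And>y. y \<in> V \<Longrightarrow> \<phi> x \<le> \<phi> y"
  shows "L w \<ge> 0"
proof (rule ccontr)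
  assume "\<not> L w \<ge> 0"
  then have neg: "L w < 0" by simp
  have line: "((\<lambda>t. x + t *\<^sub>R w) has_derivative (\<lambda>t. t *\<^sub>R w)) (at s)" for s :: real
    by (auto intro!: derivative_eq_intros)
  have zero: "\<phi>' x w = 0"
    using differential_zero_maxmin[OF \<open>x \<in> V\<close> \<open>open V\<close> assms(3)[OF \<open>x \<in> V\<close>]] min by metis
  have "((\<lambda>t. \<phi>' (x + t *\<^sub>R w) w) has_derivative (\<lambda>t. L (t *\<^sub>R w))) (at 0)"
    using has_derivative_compose[OF line[of 0], of "\<lambda>y. \<phi>' y w" L] assms(4) by simp
  moreover have "L (t *\<^sub>R w) = L w * t" for t
    using linear_scale[OF has_derivative_linear[OF assms(4)]] by simp
  ultimately have "DERIV (\<lambda>t. \<phi>' (x + t *\<^sub>R w) w) 0 :> L w"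
    by (simp add: has_field_derivative_def)
  from DERIV_neg_dec_right[OF this neg] obtain d where d: "d > 0"
    and dec: "\<And>h. 0 < h \<Longrightarrow> h < d \<Longrightarrow> \<phi>' (x + h *\<^sub>R w) w < 0"
    using zero by auto
  have "open ((\<lambda>t. x + t *\<^sub>R w) -` V)"
    using \<open>open V\<close> by (intro open_vimage) (auto intro!: continuous_intros)
  then obtain e where e: "e > 0" "ball 0 e \<subseteq> (\<lambda>t. x + t *\<^sub>R w) -` V"
    using \<open>x \<in> V\<close> open_contains_ball[of "(\<lambda>t. x + t *\<^sub>R w) -` V"] by force
  \<comment> \<open>\<open>d\<close> bounds the interval on which the derivative is negative,
    \<open>e\<close> the one on which the line stays in \<open>V\<close>.\<close>
  define h where "h = min d e / 2"
  have h: "0 < h" "h < d" "h < e" using d e(1) by (auto simp: h_def)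
  have inV: "x + t *\<^sub>R w \<in> V" if "0 \<le> t" "t \<le> h" for t
    using e(2) that h by (force simp: dist_real_def)
  have der: "DERIV (\<lambda>t. \<phi> (x + t *\<^sub>R w)) t :> \<phi>' (x + t *\<^sub>R w) w" if "0 \<le> t" "t \<le> h" for t
  proof -
    have "linear (\<phi>' (x + t *\<^sub>R w))"
      using assms(3)[OF inV[OF that]] by (rule has_derivative_linear)
    then have "(\<lambda>s. \<phi>' (x + t *\<^sub>R w) (s *\<^sub>R w)) = (*) (\<phi>' (x + t *\<^sub>R w) w)"
      by (auto simp: linear_scale fun_eq_iff)
    then show ?thesis
      using has_derivative_compose[OF line assms(3)[OF inV[OF that]]]
      by (simp add: has_field_derivative_def)
  qed
  obtain z where z: "z > 0" "z < h"
    "\<phi> (x + h *\<^sub>R w) - \<phi> (x + 0 *\<^sub>R w) = (h - 0) * \<phi>' (x + z *\<^sub>R w) w"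
    using MVT2[OF h(1) der] by auto
  have "\<phi> (x + h *\<^sub>R w) < \<phi> x"
    using z(3) mult_pos_neg[OF h(1) dec[of z]] z(1,2) h(2) by simp
  then show False using min[OF inV[of h]] h(1) by simp
qed

text \<open>The Hessian is taken in chart coordinates along constant directions. Its difference from
  the intrinsic one is a tangential term, which pairs to zero with \<open>W\<close> at a critical
  point.\<close>

lemma translating_soliton_no_local_min:
  fixes A :: "('n::finite, 'm) atlas" and F :: "'m \<Rightarrow> real^('n + 'k::finite)"
  assumes W: "norm W = 1" and sol: "translating_soliton W A F" and imm: "smooth_immersion A F"
    and chart: "(V, \<psi>) \<in> A" "open V" and x: "x \<in> V"
  shows "\<exists>y\<in>V. F (\<psi> y) \<bullet> W < F (\<psi> x) \<bullet> W"
proof (rule ccontr)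
  define f where "f = F \<circ> \<psi>"
  define D where "D y = frechet_derivative f (at y)" for y
  assume "\<not> ?thesis"
  then have min: "f x \<bullet> W \<le> f y \<bullet> W" if "y \<in> V" for y
    using that by (force simp: f_def)
  have smf: "smooth_on V f" and inj: "inj (frechet_derivative f (at x))"
    using imm chart x by (auto simp: smooth_immersion_def f_def)
  obtain U v and \<nu> :: "'k \<Rightarrow> real^'n \<Rightarrow> real^('n + 'k)"
    where U: "open U" "x \<in> U" "U \<subseteq> V" and frame: "adapted_frame f U v \<nu>"
    using adapted_frame_exists[OF chart(2) smf x inj] by blast
  have D: "(f has_derivative D y) (at y)" if "y \<in> V" for y
    unfolding D_def using smooth_on_has_derivative[OF smf that] .
  define D2 where "D2 w = frechet_derivative (\<lambda>y. D y w) (at x)" for w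
  have D2: "((\<lambda>y. D y w) has_derivative D2 w) (at x)" for w
    unfolding D_def D2_def
    using smooth_on_has_derivative[OF smooth_on_frechet_derivative[OF smf] x] .
  have DW: "((\<lambda>y. f y \<bullet> W) has_derivative (\<lambda>w. D y w \<bullet> W)) (at y)" if "y \<in> V" for y
    using D[OF that] by (rule has_derivative_inner_left)
  have "(\<lambda>w. D x w \<bullet> W) = (\<lambda>w. 0)"
    using differential_zero_maxmin[OF x chart(2) DW[OF x]] min by blast
  then have crit: "D x w \<bullet> W = 0" for w by metis
  have D2W: "((\<lambda>y. D y w \<bullet> W) has_derivative (\<lambda>u. D2 w u \<bullet> W)) (at x)" for w
    using D2 by (rule has_derivative_inner_left)
  have hess: "D2 w w \<bullet> W \<ge> 0" for w
    using second_derivative_nonneg_at_min[OF chart(2) x DW D2W[of w] min] .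
  have W_exp: "(\<Sum>\<alpha>\<in>UNIV. (\<nu> \<alpha> x \<bullet> W) *\<^sub>R \<nu> \<alpha> x) = W"
    using adapted_frame_normal_expansion[OF frame U(2)] crit by (simp add: D_def)
  \<comment> \<open>Differentiating \<nu> \<bullet> df(w) = 0 moves the derivative from the normal
    field to the differential. The direction \<open>w\<close> is frozen at its value at
    \<open>x\<close>, so no derivative of the frame \<open>v\<close> appears.\<close>
  have h: "second_fund_form f v \<nu> \<alpha> j j x = - (\<nu> \<alpha> x \<bullet> D2 (v j x) (v j x))" for \<alpha> j
  proof -
    let ?w = "v j x"
    have "smooth_on U (\<nu> \<alpha>)" using frame by (simp add: adapted_frame_def)
    then have "(\<nu> \<alpha> has_derivative frechet_derivative (\<nu> \<alpha>) (at x)) (at x)"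
      using U(2) by (rule smooth_on_has_derivative)
    from has_derivative_inner[OF this D2[of ?w]]
    have "((\<lambda>y. \<nu> \<alpha> y \<bullet> D y ?w) has_derivative
        (\<lambda>u. \<nu> \<alpha> x \<bullet> D2 ?w u + frechet_derivative (\<nu> \<alpha>) (at x) u \<bullet> D x ?w)) (at x)" .
    moreover have "((\<lambda>y. \<nu> \<alpha> y \<bullet> D y ?w) has_derivative (\<lambda>u. 0)) (at x)"
    proof (rule has_derivative_transform_within_open[OF has_derivative_const U(1,2)])
      show "0 = \<nu> \<alpha> y \<bullet> D y ?w" if "y \<in> U" for y
        using frame that by (simp add: adapted_frame_def D_def)
    qed
    ultimately have "(\<lambda>u. \<nu> \<alpha> x \<bullet> D2 ?w u + frechet_derivative (\<nu> \<alpha>) (at x) u \<bullet> D x ?w) = (\<lambda>u. 0)"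
      by (rule has_derivative_unique)
    then have "\<nu> \<alpha> x \<bullet> D2 ?w ?w + frechet_derivative (\<nu> \<alpha>) (at x) ?w \<bullet> D x ?w = 0"
      by metis
    then show ?thesis by (simp add: second_fund_form_def D_def)
  qed
  have H: "mean_curv f v \<nu> \<alpha> x = \<nu> \<alpha> x \<bullet> W" for \<alpha>
    using sol chart(1) U frame unfolding translating_soliton_def f_def by blast
  \<comment> \<open>The expansion of \<open>W\<close> is used twice: first to bring in the mean
    curvatures, then, after the sums are exchanged, to reassemble \<open>W\<close> next to the
    Hessian. The outcome is 1 = -(trace of the Hessian of the height).\<close>
  have "1 = W \<bullet> W" using W by (simp add: norm_eq_1)
  also have "\<dots> = (\<Sum>\<alpha>\<in>UNIV. (\<nu> \<alpha> x \<bullet> W) *\<^sub>R \<nu> \<alpha> x) \<bullet> W"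
    by (simp add: W_exp)
  also have "\<dots> = (\<Sum>\<alpha>\<in>UNIV. (\<nu> \<alpha> x \<bullet> W) * mean_curv f v \<nu> \<alpha> x)"
    by (simp add: inner_sum_left H)
  also have "\<dots> = (\<Sum>\<alpha>\<in>UNIV. \<Sum>j\<in>UNIV. - ((\<nu> \<alpha> x \<bullet> W) *\<^sub>R \<nu> \<alpha> x \<bullet> D2 (v j x) (v j x)))"
    by (simp add: mean_curv_def h sum_distrib_left)
  also have "\<dots> = (\<Sum>j\<in>UNIV. - (D2 (v j x) (v j x) \<bullet> (\<Sum>\<alpha>\<in>UNIV. (\<nu> \<alpha> x \<bullet> W) *\<^sub>R \<nu> \<alpha> x)))"
    by (subst sum.swap) (simp add: inner_sum_right sum_negf inner_commute)
  also have "\<dots> = (\<Sum>j\<in>UNIV. - (D2 (v j x) (v j x) \<bullet> W))"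
    by (simp add: W_exp)
  also have "\<dots> \<le> 0"
    using hess by (intro sum_nonpos) simp
  finally show False by simp
qed

subsection \<open>Lengths of curves\<close>

text \<open>The fundamental theorem with finitely many exceptions yields a gauge integral, applied
  to one scalar component of the derivative. This component is dominated by the speed, so finite
  length makes it Lebesgue integrable and the two integrals agree.\<close>

lemma norm_diff_le_nn_integral_vector_derivative:
  fixes g :: "real \<Rightarrow> 'e::euclidean_space"
  assumes "continuous_on {0..1} g" "finite S"
    and diff: "\<And>t. t \<in> {0<..<1} - S \<Longrightarrow> g differentiable (at t)"
  shows "ennreal (norm (g 1 - g 0)) \<le>
    (\<integral>\<^sup>+t\<in>{0..1}. ennreal (norm (vector_derivative g (at t))) \<partial>lborel)" (is "_ \<le> ?L")
proof (cases "?L = \<infinity>")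
  case True
  then show ?thesis by simp
next
  case False
  \<comment> \<open>The direction of the chord, whose component of \<open>g\<close> increases by
    exactly the chord length. It is 0 for a closed curve, hence only
    \<open>norm e \<le> 1\<close>.\<close>
  define e where "e = sgn (g 1 - g 0)"
  have e: "norm e \<le> 1" "(g 1 - g 0) \<bullet> e = norm (g 1 - g 0)"
    by (cases "g 1 = g 0"; simp add: e_def sgn_div_norm dot_square_norm power2_eq_square)+
  define q where "q t = (vector_derivative g (at t) \<bullet> e) * indicator {0..1} t" for t :: real
  have "((\<lambda>t. vector_derivative g (at t) \<bullet> e) has_integral (g 1 \<bullet> e - g 0 \<bullet> e)) {0..1}"
  proof (rule fundamental_theorem_of_calculus_interior_strong[OF \<open>finite S\<close>])
    show "((\<lambda>t. g t \<bullet> e) has_vector_derivative vector_derivative g (at t) \<bullet> e) (at t)"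
      if "t \<in> {0<..<1} - S" for t
      using diff[OF that] unfolding vector_derivative_works
      by (rule bounded_linear.has_vector_derivative[OF bounded_linear_inner_left])
    show "continuous_on {0..1} (\<lambda>t. g t \<bullet> e)"
      using assms(1) by (intro continuous_intros)
  qed simp
  then have int: "((\<lambda>t. vector_derivative g (at t) \<bullet> e) has_integral norm (g 1 - g 0)) {0..1}"
    using e(2) by (simp add: inner_diff_left)
  have meas: "q \<in> borel_measurable lebesgue"
    unfolding q_def using has_integral_implies_lebesgue_measurable_real[OF int] .
  \<comment> \<open>The gauge integral matches integration over \<open>lebesgue\<close>, while
    lengths are integrals over \<open>lborel\<close>.\<close>
  have "(\<integral>\<^sup>+t. ennreal (norm (q t)) \<partial>lebesgue) = (\<integral>\<^sup>+t. ennreal (norm (q t)) \<partial>lborel)"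
    by (rule nn_integral_completion)
  also have "\<dots> \<le> ?L"
  proof (rule nn_integral_mono)
    fix t
    have "\<bar>vector_derivative g (at t) \<bullet> e\<bar> \<le> norm (vector_derivative g (at t)) * norm e"
      by (rule Cauchy_Schwarz_ineq2)
    also have "\<dots> \<le> norm (vector_derivative g (at t)) * 1"
      using e(1) by (intro mult_left_mono) auto
    finally show "ennreal (norm (q t)) \<le> ennreal (norm (vector_derivative g (at t))) * indicator {0..1} t"
      by (auto simp: q_def indicator_def intro!: ennreal_leI)
  qed
  finally have le: "(\<integral>\<^sup>+t. ennreal (norm (q t)) \<partial>lebesgue) \<le> ?L" .
  then have "integrable lebesgue q"
    using False meas by (intro integrableI_bounded) (auto simp: top.not_eq_extremum)
  moreover have "(q has_integral norm (g 1 - g 0)) UNIV"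
  proof -
    have "q = (\<lambda>t. if t \<in> {0..1} then vector_derivative g (at t) \<bullet> e else 0)"
      by (auto simp: q_def fun_eq_iff)
    then show ?thesis
      using int has_integral_restrict_UNIV[of "{0..1}"] by metis
  qed
  ultimately have "integral\<^sup>L lebesgue q = norm (g 1 - g 0)"
    using has_integral_integral_lebesgue has_integral_unique by blast
  then show ?thesis
    using integral_norm_bound_ennreal[OF \<open>integrable lebesgue q\<close>] le by simp
qed

section \<open>Charts, continuity of the immersion, and chord against length\<close>

lemma smooth_manifold_chartE:
  assumes "smooth_manifold M A" "p \<in> topspace M"
  obtains V \<psi> x where "(V, \<psi>) \<in> A" "x \<in> V" "p = \<psi> x"
  using assms unfolding smooth_manifold_def by blast

lemma chart_homeomorphism:
  assumes "smooth_manifold M A" "(V, \<psi>) \<in> A"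
  shows "open V" "openin M (\<psi> ` V)" "inj_on \<psi> V"
    and "homeomorphic_map (top_of_set V) (subtopology M (\<psi> ` V)) \<psi>"
    and "continuous_map (subtopology M (\<psi> ` V)) (top_of_set V) (inv_into V \<psi>)"
proof -
  show V: "open V" "openin M (\<psi> ` V)"
    and hom: "homeomorphic_map (top_of_set V) (subtopology M (\<psi> ` V)) \<psi>"
    using assms unfolding smooth_manifold_def embedding_map_def by fastforce+
  from hom show inj: "inj_on \<psi> V"
    by (simp add: homeomorphic_map_def)
  obtain g where g: "homeomorphic_maps (top_of_set V) (subtopology M (\<psi> ` V)) \<psi> g"
    using hom homeomorphic_map_maps by blast
  show "continuous_map (subtopology M (\<psi> ` V)) (top_of_set V) (inv_into V \<psi>)"
  proof (rule continuous_map_eq)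
    show "continuous_map (subtopology M (\<psi> ` V)) (top_of_set V) g"
      using g by (simp add: homeomorphic_maps_def)
    show "g p = inv_into V \<psi> p" if "p \<in> topspace (subtopology M (\<psi> ` V))" for p
      using that g inj by (auto simp: homeomorphic_maps_def)
  qed
qed

lemma smooth_immersion_continuous_map:
  assumes M: "smooth_manifold M A" and F: "smooth_immersion A F"
  shows "continuous_map M euclidean F"
proof (rule pasting_lemma[where I = A and T = "\<lambda>(V, \<psi>). \<psi> ` V" and f = "\<lambda>_. F"])
  show "openin M (case c of (V, \<psi>) \<Rightarrow> \<psi> ` V)" if "c \<in> A" for c
    using chart_homeomorphism(2)[OF M] that by (cases c) auto
  show "\<exists>c. c \<in> A \<and> p \<in> (case c of (V, \<psi>) \<Rightarrow> \<psi> ` V) \<and> F p = F p" if "p \<in> topspace M" for p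
    using M that unfolding smooth_manifold_def by blast
  show "continuous_map (subtopology M (case c of (V, \<psi>) \<Rightarrow> \<psi> ` V)) euclidean F" if "c \<in> A" for c
  proof -
    obtain V \<psi> where c: "c = (V, \<psi>)" by (cases c)
    have cA: "(V, \<psi>) \<in> A" using that c by simp
    have "smooth_on V (F \<circ> \<psi>)"
      using F cA unfolding smooth_immersion_def by blast
    then have "continuous_map (top_of_set V) euclidean (F \<circ> \<psi>)"
      unfolding continuous_map_iff_continuous by (rule smooth_on_imp_continuous_on)
    from continuous_map_compose[OF chart_homeomorphism(5)[OF M cA] this]
    have "continuous_map (subtopology M (\<psi> ` V)) euclidean ((F \<circ> \<psi>) \<circ> inv_into V \<psi>)" .
    then have "continuous_map (subtopology M (\<psi> ` V)) euclidean F"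
      by (rule continuous_map_eq) (auto simp: f_inv_into_f)
    then show ?thesis by (simp add: c)
  qed
qed simp

text \<open>The regularity of a curve is given only on intervals mapped into a single chart. The
  bisection principle \<open>Bolzano\<close> patches these local statements together over the unit
  interval.\<close>

lemma piecewise_C1_curve_image_differentiable:
  assumes M: "smooth_manifold M A" and F: "smooth_immersion A F"
    and \<gamma>: "piecewise_C1_curve M A \<gamma>"
  obtains S where "finite S" "\<And>t. t \<in> {0<..<1} - S \<Longrightarrow> (F \<circ> \<gamma>) differentiable (at t)"
proof -
  have path: "continuous_map (top_of_set {0..1}) M \<gamma>"
    using \<gamma> by (simp add: piecewise_C1_curve_def pathin_def)
  \<comment> \<open>The guard is there because \<open>Bolzano\<close> tests all short intervals
    around a point, including those that leave the unit interval.\<close>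
  define P where "P a b \<longleftrightarrow> (0 \<le> a \<and> b \<le> 1 \<longrightarrow>
    (\<exists>S. finite S \<and> (\<forall>t\<in>{a<..<b} - S. (F \<circ> \<gamma>) differentiable (at t))))" for a b :: real
  have "P 0 1"
  proof (rule Bolzano)
    fix a b c :: real
    assume "P a b" "P b c" and le: "a \<le> b" "b \<le> c"
    show "P a c"
      unfolding P_def
    proof
      assume "0 \<le> a \<and> c \<le> 1"
      then obtain S S' where S: "finite S" "\<forall>t\<in>{a<..<b} - S. (F \<circ> \<gamma>) differentiable (at t)"
        and S': "finite S'" "\<forall>t\<in>{b<..<c} - S'. (F \<circ> \<gamma>) differentiable (at t)"
        using \<open>P a b\<close> \<open>P b c\<close> le unfolding P_def by force
      \<comment> \<open>The junction \<open>b\<close> lies in neither open subinterval, so it joins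
        the exceptional set.\<close>
      have "(F \<circ> \<gamma>) differentiable (at t)" if "t \<in> {a<..<c} - (insert b (S \<union> S'))" for t
        using S(2) S'(2) that by (cases t b rule: linorder_cases) auto
      then show "\<exists>S. finite S \<and> (\<forall>t\<in>{a<..<c} - S. (F \<circ> \<gamma>) differentiable (at t))"
        using S(1) S'(1) by (intro exI[of _ "insert b (S \<union> S')"]) simp
    qed
  next
    fix x :: real assume x: "0 \<le> x" "x \<le> 1"
    then have "\<gamma> x \<in> topspace M"
      using path continuous_map_funspace[OF path] by auto
    then obtain V \<psi> where c: "(V, \<psi>) \<in> A" and xc: "\<gamma> x \<in> \<psi> ` V"
      using M unfolding smooth_manifold_def by blast
    have "openin (top_of_set {0..1}) {t \<in> {0..1}. \<gamma> t \<in> \<psi> ` V}"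
      using openin_continuous_map_preimage[OF path chart_homeomorphism(2)[OF M c]] by simp
    moreover have "x \<in> {t \<in> {0..1}. \<gamma> t \<in> \<psi> ` V}"
      using x xc by simp
    ultimately have "\<exists>d>0. \<forall>t\<in>{0..1}. dist t x < d \<longrightarrow> t \<in> {t \<in> {0..1}. \<gamma> t \<in> \<psi> ` V}"
      unfolding openin_euclidean_subtopology_iff by blast
    then obtain d where d: "d > 0" "\<And>t. t \<in> {0..1} \<Longrightarrow> dist t x < d \<Longrightarrow> \<gamma> t \<in> \<psi> ` V"
      by blast
    have "P a b" if ab: "a \<le> x" "x \<le> b" "b - a < d" for a b
      unfolding P_def
    proof
      assume le: "0 \<le> a \<and> b \<le> 1"
      have sub: "\<gamma> ` {a..b} \<subseteq> \<psi> ` V"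
        using ab le d(2) by (auto simp: dist_real_def)
      have "(inv_into V \<psi> \<circ> \<gamma>) piecewise_C1_differentiable_on {a..b}"
        using \<gamma> c le ab sub unfolding piecewise_C1_curve_def by fastforce
      then obtain S where "finite S" and S: "(inv_into V \<psi> \<circ> \<gamma>) C1_differentiable_on ({a..b} - S)"
        unfolding piecewise_C1_differentiable_on_def by blast
      have "(F \<circ> \<gamma>) differentiable (at t)" if t: "t \<in> {a<..<b} - S" for t
      proof -
        have \<gamma>V: "\<gamma> s \<in> \<psi> ` V" if "s \<in> {a<..<b}" for s
          using sub that by auto
        have "smooth_on V (F \<circ> \<psi>)"
          using F c unfolding smooth_immersion_def by blast
        then have "(F \<circ> \<psi>) differentiable (at ((inv_into V \<psi> \<circ> \<gamma>) t))"
          using smooth_on_has_derivative[of V] inv_into_into[OF \<gamma>V[of t]] t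
          unfolding differentiable_def by auto
        moreover have "(inv_into V \<psi> \<circ> \<gamma>) differentiable (at t)"
          using S t unfolding C1_differentiable_on_eq by auto
        ultimately have "((F \<circ> \<psi>) \<circ> (inv_into V \<psi> \<circ> \<gamma>)) differentiable (at t)"
          by (intro differentiable_chain_at)
        then obtain D where "(((F \<circ> \<psi>) \<circ> (inv_into V \<psi> \<circ> \<gamma>)) has_derivative D) (at t)"
          unfolding differentiable_def by blast
        then have "((F \<circ> \<gamma>) has_derivative D) (at t)"
          by (rule has_derivative_transform_within_open[of _ _ _ _ "{a<..<b}"])
             (use t \<gamma>V in \<open>auto simp: f_inv_into_f\<close>)
        then show ?thesis unfolding differentiable_def by blast
      qed
      then show "\<exists>S. finite S \<and> (\<forall>t\<in>{a<..<b} - S. (F \<circ> \<gamma>) differentiable (at t))"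
        using \<open>finite S\<close> by blast
    qed
    then show "\<exists>d>0. \<forall>a b. a \<le> x \<and> x \<le> b \<and> b - a < d \<longrightarrow> P a b"
      using d(1) by blast
  qed simp
  then show ?thesis unfolding P_def using that by auto
qed

lemma dist_le_curve_length:
  assumes M: "smooth_manifold M A" and F: "smooth_immersion A F"
    and \<gamma>: "piecewise_C1_curve M A \<gamma>"
  shows "ennreal (norm (F (\<gamma> 1) - F (\<gamma> 0))) \<le> curve_length F \<gamma>"
proof -
  obtain S where S: "finite S" "\<And>t. t \<in> {0<..<1} - S \<Longrightarrow> (F \<circ> \<gamma>) differentiable (at t)"
    using piecewise_C1_curve_image_differentiable[OF assms] by blast
  have "continuous_map (top_of_set {0..1}) M \<gamma>"
    using \<gamma> by (simp add: piecewise_C1_curve_def pathin_def)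
  from continuous_map_compose[OF this smooth_immersion_continuous_map[OF M F]]
  have "continuous_on {0..1} (F \<circ> \<gamma>)" by simp
  from norm_diff_le_nn_integral_vector_derivative[OF this S]
  show ?thesis by (simp add: curve_length_def)
qed

section \<open>Joining points by curves of bounded speed\<close>

lemma smooth_on_affine_line:
  assumes "smooth_on U f" "\<And>t. t \<in> T \<Longrightarrow> x + t *\<^sub>R w \<in> U"
  shows "t \<in> T \<Longrightarrow> ((\<lambda>t. f (x + t *\<^sub>R w)) has_vector_derivative
            frechet_derivative f (at (x + t *\<^sub>R w)) w) (at t)"
    and "continuous_on T (\<lambda>t. frechet_derivative f (at (x + t *\<^sub>R w)) w)"
proof -
  show "((\<lambda>t. f (x + t *\<^sub>R w)) has_vector_derivative
            frechet_derivative f (at (x + t *\<^sub>R w)) w) (at t)" if t: "t \<in> T" for t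
  proof -
    note f = smooth_on_has_derivative[OF assms(1) assms(2)[OF t]]
    have "((\<lambda>t. x + t *\<^sub>R w) has_derivative (\<lambda>t. t *\<^sub>R w)) (at t)"
      by (auto intro!: derivative_eq_intros)
    from has_derivative_compose[OF this f]
    show ?thesis
      by (simp add: has_vector_derivative_def linear_scale[OF has_derivative_linear[OF f]])
  qed
  have "continuous_on U (\<lambda>y. frechet_derivative f (at y) w)"
    using smooth_on_imp_continuous_on[OF smooth_on_frechet_derivative[OF assms(1)]] .
  then show "continuous_on T (\<lambda>t. frechet_derivative f (at (x + t *\<^sub>R w)) w)"
    by (rule continuous_on_compose2) (use assms(2) in \<open>auto intro!: continuous_intros\<close>)
qed

text \<open>Derivatives are two-sided here, so agreement on the closed interval transfers them only
  at interior points; the two endpoints are added to the exceptional set.\<close>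

lemma piecewise_C1_differentiable_on_eq:
  fixes f g :: "real \<Rightarrow> 'a::real_normed_vector"
  assumes "f piecewise_C1_differentiable_on {a..b}" "\<And>t. t \<in> {a..b} \<Longrightarrow> f t = g t"
  shows "g piecewise_C1_differentiable_on {a..b}"
proof -
  obtain S D where S: "finite S" "continuous_on {a..b} f" "continuous_on ({a..b} - S) D"
    and D: "\<And>t. t \<in> {a..b} - S \<Longrightarrow> (f has_vector_derivative D t) (at t)"
    using assms(1) unfolding piecewise_C1_differentiable_on_def C1_differentiable_on_def by blast
  have "(g has_vector_derivative D t) (at t)" if "t \<in> {a..b} - insert a (insert b S)" for t
    by (rule has_vector_derivative_transform_within_open[of f _ _ "{a<..<b}"])
       (use that assms(2) D in auto)
  moreover have "continuous_on ({a..b} - insert a (insert b S)) D"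
    using S(3) by (rule continuous_on_subset) auto
  ultimately have "g C1_differentiable_on ({a..b} - insert a (insert b S))"
    unfolding C1_differentiable_on_def by blast
  moreover have "continuous_on {a..b} g"
    using S(2) assms(2) by (rule continuous_on_eq)
  ultimately show ?thesis
    unfolding piecewise_C1_differentiable_on_def using S(1) by (meson finite_insert)
qed

lemma piecewise_C1_curveD:
  assumes "piecewise_C1_curve M A \<gamma>" "(V, \<psi>) \<in> A" "0 \<le> a" "a \<le> b" "b \<le> 1" "\<gamma> ` {a..b} \<subseteq> \<psi> ` V"
  shows "(inv_into V \<psi> \<circ> \<gamma>) piecewise_C1_differentiable_on {a..b}"
  using assms unfolding piecewise_C1_curve_def by fast

text \<open>
  Uniformly bounded speed replaces finite length here because it is trivially stable under
  concatenation.
\<close>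
definition bounded_speed_joined ::
    "'m topology \<Rightarrow> ('n::finite, 'm) atlas \<Rightarrow> ('m \<Rightarrow> 'e::euclidean_space) \<Rightarrow> 'm \<Rightarrow> 'm \<Rightarrow> bool" where
  "bounded_speed_joined M A F p q \<longleftrightarrow>
     (\<exists>\<gamma> B S. piecewise_C1_curve M A \<gamma> \<and> \<gamma> 0 = p \<and> \<gamma> 1 = q \<and> finite S \<and>
        (\<forall>t\<in>{0..1} - S. \<exists>D. ((F \<circ> \<gamma>) has_vector_derivative D) (at t) \<and> norm D \<le> B))"

lemma bounded_speed_joined_curve_length:
  assumes "bounded_speed_joined M A F p q"
  obtains \<gamma> where "piecewise_C1_curve M A \<gamma>" "\<gamma> 0 = p" "\<gamma> 1 = q" "curve_length F \<gamma> < \<infinity>"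
proof -
  obtain \<gamma> B S where \<gamma>: "piecewise_C1_curve M A \<gamma>" "\<gamma> 0 = p" "\<gamma> 1 = q" and S: "finite S"
    and D: "\<forall>t\<in>{0..1} - S. \<exists>D. ((F \<circ> \<gamma>) has_vector_derivative D) (at t) \<and> norm D \<le> B"
    using assms unfolding bounded_speed_joined_def by blast
  have bound: "norm (vector_derivative (F \<circ> \<gamma>) (at t)) \<le> B" if "t \<in> {0..1} - S" for t
    using bspec[OF D that] vector_derivative_at by blast
  have "AE t in lborel. t \<notin> S"
    using S by (intro AE_not_in finite_imp_null_set_lborel)
  then have "AE t in lborel. ennreal (norm (vector_derivative (F \<circ> \<gamma>) (at t))) * indicator {0..1} t
      \<le> ennreal B * indicator {0..1} t"
    by (rule AE_mp) (auto simp: indicator_def intro!: ennreal_leI bound)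
  then have "curve_length F \<gamma> \<le> (\<integral>\<^sup>+t\<in>{0..1::real}. ennreal B \<partial>lborel)"
    unfolding curve_length_def by (rule nn_integral_mono_AE)
  also have "\<dots> < \<infinity>"
    by (simp add: nn_integral_cmult_indicator)
  finally show ?thesis using that[OF \<gamma>] by blast
qed

text \<open>Seen from another chart, the image of a straight segment is a transition map along a
  line, hence C1. Its speed in the ambient space is continuous on a compact interval, hence
  bounded.\<close>

lemma bounded_speed_joined_chart_segment:
  assumes M: "smooth_manifold M A" and F: "smooth_immersion A F" and c: "(V, \<psi>) \<in> A"
    and seg: "\<And>t. t \<in> {0..1} \<Longrightarrow> x + t *\<^sub>R w \<in> V"
  shows "bounded_speed_joined M A F (\<psi> x) (\<psi> (x + w))"
proof -
  define \<gamma> where "\<gamma> = (\<lambda>t. \<psi> (x + t *\<^sub>R w))"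
  have "continuous_map (top_of_set V) M \<psi>"
    using homeomorphic_imp_continuous_map[OF chart_homeomorphism(4)[OF M c]]
    by (simp add: continuous_map_in_subtopology)
  moreover have "continuous_map (top_of_set {0..1}) (top_of_set V) (\<lambda>t::real. x + t *\<^sub>R w)"
    using seg by (auto intro!: continuous_intros)
  ultimately have "continuous_map (top_of_set {0..1}) M (\<psi> \<circ> (\<lambda>t. x + t *\<^sub>R w))"
    by (rule continuous_map_compose[rotated])
  then have path: "pathin M \<gamma>"
    by (simp add: pathin_def \<gamma>_def o_def)
  have "(inv_into V' \<psi>' \<circ> \<gamma>) piecewise_C1_differentiable_on {a..b}"
    if c': "(V', \<psi>') \<in> A" and ab: "0 \<le> a" "b \<le> 1" and sub: "\<gamma> ` {a..b} \<subseteq> \<psi>' ` V'" for V' \<psi>' a b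
  proof -
    have sm: "smooth_on {y \<in> V. \<psi> y \<in> \<psi>' ` V'} (inv_into V' \<psi>' \<circ> \<psi>)"
      using M c c' unfolding smooth_manifold_def by fast
    have mem: "x + t *\<^sub>R w \<in> {y \<in> V. \<psi> y \<in> \<psi>' ` V'}" if "t \<in> {a..b}" for t
      using that sub seg[of t] ab by (auto simp: \<gamma>_def)
    have "(\<lambda>t. (inv_into V' \<psi>' \<circ> \<psi>) (x + t *\<^sub>R w)) C1_differentiable_on {a..b}"
      unfolding C1_differentiable_on_def
    proof (intro exI conjI ballI)
      show "((\<lambda>t. (inv_into V' \<psi>' \<circ> \<psi>) (x + t *\<^sub>R w)) has_vector_derivative
          frechet_derivative (inv_into V' \<psi>' \<circ> \<psi>) (at (x + t *\<^sub>R w)) w) (at t)" if "t \<in> {a..b}" for t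
        by (rule smooth_on_affine_line(1)[OF sm mem that])
      show "continuous_on {a..b} (\<lambda>t. frechet_derivative (inv_into V' \<psi>' \<circ> \<psi>) (at (x + t *\<^sub>R w)) w)"
        by (rule smooth_on_affine_line(2)[OF sm mem])
    qed
    then show ?thesis
      by (intro C1_differentiable_imp_piecewise) (simp add: \<gamma>_def o_def)
  qed
  then have curve: "piecewise_C1_curve M A \<gamma>"
    using path unfolding piecewise_C1_curve_def by blast
  have smf: "smooth_on V (F \<circ> \<psi>)"
    using F c unfolding smooth_immersion_def by blast
  define D where "D t = frechet_derivative (F \<circ> \<psi>) (at (x + t *\<^sub>R w)) w" for t
  have "compact (D ` {0..1})"
    unfolding D_def
    by (intro compact_continuous_image smooth_on_affine_line(2)[OF smf] seg compact_Icc)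
  then obtain B where B: "\<And>t. t \<in> {0..1} \<Longrightarrow> norm (D t) \<le> B"
    using compact_imp_bounded bounded_iff by (metis imageI)
  have "((F \<circ> \<gamma>) has_vector_derivative D t) (at t)" if "t \<in> {0..1}" for t
    using smooth_on_affine_line(1)[OF smf, where T = "{0..1}", OF seg that] by (simp add: D_def \<gamma>_def o_def)
  then have "\<forall>t\<in>{0..1} - {}. \<exists>D. ((F \<circ> \<gamma>) has_vector_derivative D) (at t) \<and> norm D \<le> B"
    using B by blast
  moreover have "\<gamma> 0 = \<psi> x" "\<gamma> 1 = \<psi> (x + w)" by (simp_all add: \<gamma>_def)
  ultimately show ?thesis
    unfolding bounded_speed_joined_def using curve finite.emptyI by blast
qed

text \<open>Concatenation at double speed. The work lies in checking the C1 condition in a chart for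
  an interval that may lie on either side of the junction 1/2 or contain it.\<close>

lemma bounded_speed_joined_trans:
  assumes "bounded_speed_joined M A F p q" "bounded_speed_joined M A F q r"
  shows "bounded_speed_joined M A F p r"
proof -
  obtain \<gamma>\<^sub>1 B\<^sub>1 S\<^sub>1 where \<gamma>\<^sub>1: "piecewise_C1_curve M A \<gamma>\<^sub>1" "\<gamma>\<^sub>1 0 = p" "\<gamma>\<^sub>1 1 = q" and S\<^sub>1: "finite S\<^sub>1"
    and D\<^sub>1: "\<forall>t\<in>{0..1} - S\<^sub>1. \<exists>D. ((F \<circ> \<gamma>\<^sub>1) has_vector_derivative D) (at t) \<and> norm D \<le> B\<^sub>1"
    using assms(1) unfolding bounded_speed_joined_def by blast
  obtain \<gamma>\<^sub>2 B\<^sub>2 S\<^sub>2 where \<gamma>\<^sub>2: "piecewise_C1_curve M A \<gamma>\<^sub>2" "\<gamma>\<^sub>2 0 = q" "\<gamma>\<^sub>2 1 = r" and S\<^sub>2: "finite S\<^sub>2"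
    and D\<^sub>2: "\<forall>t\<in>{0..1} - S\<^sub>2. \<exists>D. ((F \<circ> \<gamma>\<^sub>2) has_vector_derivative D) (at t) \<and> norm D \<le> B\<^sub>2"
    using assms(2) unfolding bounded_speed_joined_def by blast
  define \<gamma> where "\<gamma> = (\<lambda>t::real. if t \<le> 1/2 then \<gamma>\<^sub>1 (2 * t) else \<gamma>\<^sub>2 (2 * t - 1))"
  let ?I = "top_of_set {0..1::real}"
  have path\<^sub>1: "continuous_map ?I M \<gamma>\<^sub>1" and path\<^sub>2: "continuous_map ?I M \<gamma>\<^sub>2"
    using \<gamma>\<^sub>1(1) \<gamma>\<^sub>2(1) by (simp_all add: piecewise_C1_curve_def pathin_def)
  have path: "pathin M \<gamma>"
    unfolding pathin_def \<gamma>_def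
  proof (rule continuous_map_cases_le)
    have "continuous_map (top_of_set {0..1/2}) ?I (\<lambda>t. 2 * t)"
      by (auto intro!: continuous_intros)
    from continuous_map_compose[OF this path\<^sub>1]
    have "continuous_map (top_of_set {0..1/2}) M (\<lambda>t. \<gamma>\<^sub>1 (2 * t))"
      by (simp add: o_def)
    moreover have "{0..1} \<inter> {t \<in> topspace ?I. t \<le> 1/2} = {0..1/2}" by auto
    ultimately show "continuous_map (subtopology ?I {t \<in> topspace ?I. t \<le> 1/2}) M (\<lambda>t. \<gamma>\<^sub>1 (2 * t))"
      by (simp only: subtopology_subtopology)
    have "continuous_map (top_of_set {1/2..1}) ?I (\<lambda>t. 2 * t - 1)"
      by (auto intro!: continuous_intros)
    from continuous_map_compose[OF this path\<^sub>2]
    have "continuous_map (top_of_set {1/2..1}) M (\<lambda>t. \<gamma>\<^sub>2 (2 * t - 1))"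
      by (simp add: o_def)
    moreover have "{0..1} \<inter> {t \<in> topspace ?I. 1/2 \<le> t} = {1/2..1}" by auto
    ultimately show "continuous_map (subtopology ?I {t \<in> topspace ?I. 1/2 \<le> t}) M (\<lambda>t. \<gamma>\<^sub>2 (2 * t - 1))"
      by (simp only: subtopology_subtopology)
    show "\<gamma>\<^sub>1 (2 * t) = \<gamma>\<^sub>2 (2 * t - 1)" if "t \<in> topspace ?I" "t = 1/2" for t
      unfolding that(2) by (simp add: \<gamma>\<^sub>1 \<gamma>\<^sub>2)
  qed auto
  have "(inv_into V \<psi> \<circ> \<gamma>) piecewise_C1_differentiable_on {a..b}"
    if c: "(V, \<psi>) \<in> A" and ab: "0 \<le> a" "a \<le> b" "b \<le> 1" and sub: "\<gamma> ` {a..b} \<subseteq> \<psi> ` V" for V \<psi> a b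
  proof -
    define h\<^sub>1 where "h\<^sub>1 = (inv_into V \<psi> \<circ> \<gamma>\<^sub>1) \<circ> (\<lambda>t. 2 *\<^sub>R t + 0)"
    define h\<^sub>2 where "h\<^sub>2 = (inv_into V \<psi> \<circ> \<gamma>\<^sub>2) \<circ> (\<lambda>t. 2 *\<^sub>R t + (-1))"
    have half\<^sub>1: "h\<^sub>1 piecewise_C1_differentiable_on {a..b'}"
      if "a \<le> b'" "b' \<le> b" "b' \<le> 1/2" for b'
    proof -
      have im: "(\<lambda>t. 2 * t + 0) ` {a..b'} = {2 * a..2 * b'}"
        using image_affinity_atLeastAtMost[of 2 0 a b'] that by simp
      have "\<gamma>\<^sub>1 s \<in> \<psi> ` V" if "s \<in> {2 * a..2 * b'}" for s
      proof -
        have "\<gamma> (s / 2) \<in> \<psi> ` V"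
          using sub that \<open>b' \<le> b\<close> by (intro subsetD[OF sub] imageI) auto
        then show ?thesis using that \<open>b' \<le> 1/2\<close> by (simp add: \<gamma>_def)
      qed
      then have "\<gamma>\<^sub>1 ` {2 * a..2 * b'} \<subseteq> \<psi> ` V" by blast
      then have "(inv_into V \<psi> \<circ> \<gamma>\<^sub>1) piecewise_C1_differentiable_on {2 * a..2 * b'}"
        using ab that by (intro piecewise_C1_curveD[OF \<gamma>\<^sub>1(1) c]) auto
      then show ?thesis
        unfolding h\<^sub>1_def im[symmetric] by (rule piecewise_C1_differentiable_affine)
    qed
    have half\<^sub>2: "h\<^sub>2 piecewise_C1_differentiable_on {a'..b}"
      if "a \<le> a'" "a' \<le> b" "1/2 \<le> a'" "\<And>s. s \<in> {2 * a' - 1..2 * b - 1} \<Longrightarrow> \<gamma>\<^sub>2 s \<in> \<psi> ` V" for a'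
    proof -
      have im: "(\<lambda>t. 2 * t + (-1)) ` {a'..b} = {2 * a' - 1..2 * b - 1}"
        using image_affinity_atLeastAtMost[of 2 "-1" a' b] that by simp
      have "\<gamma>\<^sub>2 ` {2 * a' - 1..2 * b - 1} \<subseteq> \<psi> ` V" using that(4) by blast
      then have "(inv_into V \<psi> \<circ> \<gamma>\<^sub>2) piecewise_C1_differentiable_on {2 * a' - 1..2 * b - 1}"
        using ab that(1-3) by (intro piecewise_C1_curveD[OF \<gamma>\<^sub>2(1) c]) auto
      then show ?thesis
        unfolding h\<^sub>2_def im[symmetric] by (rule piecewise_C1_differentiable_affine)
    qed
    \<comment> \<open>For \<open>s = 0\<close> the parameter is 1/2 and belongs to the first branch
      of the curve, where the common point \<open>q\<close> is reached.\<close>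
    have in\<^sub>2: "\<gamma>\<^sub>2 s \<in> \<psi> ` V" if "s \<in> {2 * a' - 1..2 * b - 1}" "a \<le> a'" "1/2 \<le> a'" for s a'
    proof -
      have mem: "\<gamma> ((s + 1) / 2) \<in> \<psi> ` V"
        using that by (intro subsetD[OF sub] imageI) auto
      have eq: "2 * ((s + 1) / 2) = s + 1" by simp
      have "\<gamma> ((s + 1) / 2) = \<gamma>\<^sub>2 s"
        unfolding \<gamma>_def eq using that \<gamma>\<^sub>1(3) \<gamma>\<^sub>2(2) by (cases "s = 0") auto
      then show ?thesis using mem by simp
    qed
    consider "b \<le> 1/2" | "a \<ge> 1/2" | "a \<le> 1/2" "1/2 \<le> b" by linarith
    then show ?thesis
    proof cases
      case 1
      from half\<^sub>1[OF ab(2) order_refl 1] show ?thesis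
        by (rule piecewise_C1_differentiable_on_eq) (use 1 in \<open>auto simp: h\<^sub>1_def \<gamma>_def\<close>)
    next
      case 2
      from half\<^sub>2[OF order_refl ab(2) 2 in\<^sub>2[OF _ order_refl 2]] show ?thesis
      proof (rule piecewise_C1_differentiable_on_eq)
        show "h\<^sub>2 t = (inv_into V \<psi> \<circ> \<gamma>) t" if "t \<in> {a..b}" for t
        proof (cases "t = 1/2")
          case True
          show ?thesis unfolding True by (simp add: h\<^sub>2_def \<gamma>_def \<gamma>\<^sub>1 \<gamma>\<^sub>2)
        next
          case False
          then show ?thesis using that 2 by (simp add: h\<^sub>2_def \<gamma>_def)
        qed
      qed
    next
      case 3
      have "(\<lambda>t. if t \<le> 1/2 then h\<^sub>1 t else h\<^sub>2 t) piecewise_C1_differentiable_on {a..b}"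
        using half\<^sub>1[OF 3 order_refl] half\<^sub>2[OF 3 order_refl in\<^sub>2[OF _ 3(1) order_refl]] 3
        by (rule piecewise_C1_differentiable_cases) (simp_all add: h\<^sub>1_def h\<^sub>2_def \<gamma>\<^sub>1 \<gamma>\<^sub>2)
      then show ?thesis
        by (rule piecewise_C1_differentiable_on_eq) (simp add: h\<^sub>1_def h\<^sub>2_def \<gamma>_def)
    qed
  qed
  then have curve: "piecewise_C1_curve M A \<gamma>"
    using path unfolding piecewise_C1_curve_def by blast
  \<comment> \<open>The rescaled exceptional sets of both halves and the junction; the factor 2 in
    \<open>B\<close> below is the doubled speed.\<close>
  define S where "S = insert (1/2) ((\<lambda>t. t / 2) ` S\<^sub>1 \<union> (\<lambda>t. (t + 1) / 2) ` S\<^sub>2)"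
  define B where "B = 2 * max B\<^sub>1 B\<^sub>2"
  have "\<exists>D. ((F \<circ> \<gamma>) has_vector_derivative D) (at t) \<and> norm D \<le> B" if t: "t \<in> {0..1} - S" for t
  proof (cases "t < 1/2")
    case True
    have "2 * t \<in> {0..1} - S\<^sub>1"
      using t True imageI[of "2 * t" S\<^sub>1 "\<lambda>t. t / 2"] by (auto simp: S_def)
    then obtain D where D: "((F \<circ> \<gamma>\<^sub>1) has_vector_derivative D) (at (2 * t))" "norm D \<le> B\<^sub>1"
      using D\<^sub>1 by blast
    have "((\<lambda>t. 2 * t) has_vector_derivative 2) (at t)"
      by (auto intro!: derivative_eq_intros)
    from vector_diff_chain_at[OF this D(1)]
    have "((F \<circ> \<gamma>) has_vector_derivative 2 *\<^sub>R D) (at t)"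
      by (rule has_vector_derivative_transform_within_open[of _ _ _ "{..<1/2}"])
         (use True in \<open>auto simp: \<gamma>_def\<close>)
    moreover have "norm (2 *\<^sub>R D) \<le> B" using D(2) by (simp add: B_def)
    ultimately show ?thesis by blast
  next
    case False
    then have gt: "t > 1/2" using t by (auto simp: S_def)
    have "2 * t - 1 \<in> {0..1} - S\<^sub>2"
      using t gt imageI[of "2 * t - 1" S\<^sub>2 "\<lambda>t. (t + 1) / 2"] by (auto simp: S_def)
    then obtain D where D: "((F \<circ> \<gamma>\<^sub>2) has_vector_derivative D) (at (2 * t - 1))" "norm D \<le> B\<^sub>2"
      using D\<^sub>2 by blast
    have "((\<lambda>t. 2 * t - 1) has_vector_derivative 2) (at t)"
      by (auto intro!: derivative_eq_intros)
    from vector_diff_chain_at[OF this D(1)]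
    have "((F \<circ> \<gamma>) has_vector_derivative 2 *\<^sub>R D) (at t)"
      by (rule has_vector_derivative_transform_within_open[of _ _ _ "{1/2<..}"])
         (use gt in \<open>auto simp: \<gamma>_def\<close>)
    moreover have "norm (2 *\<^sub>R D) \<le> B" using D(2) by (simp add: B_def)
    ultimately show ?thesis by blast
  qed
  moreover have "finite S" using S\<^sub>1 S\<^sub>2 by (simp add: S_def)
  moreover have "\<gamma> 0 = p" "\<gamma> 1 = r" using \<gamma>\<^sub>1 \<gamma>\<^sub>2 by (simp_all add: \<gamma>_def)
  ultimately show ?thesis
    unfolding bounded_speed_joined_def using curve by blast
qed

text \<open>A ball in chart coordinates is convex, so segments join its points. Having all pairs
  joined, in either order, serves both halves of the clopen argument for connectedness.\<close>

lemma bounded_speed_joined_local: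
  assumes M: "smooth_manifold M A" and F: "smooth_immersion A F" and q: "q \<in> topspace M"
  obtains N where "openin M N" "q \<in> N"
    "\<And>r s. r \<in> N \<Longrightarrow> s \<in> N \<Longrightarrow> bounded_speed_joined M A F r s"
proof -
  obtain V \<psi> x where c: "(V, \<psi>) \<in> A" and x: "x \<in> V" "q = \<psi> x"
    using smooth_manifold_chartE[OF M q] .
  note ch = chart_homeomorphism[OF M c]
  obtain e where e: "e > 0" "ball x e \<subseteq> V"
    using ch(1) x(1) open_contains_ball by blast
  have "openin (top_of_set V) (ball x e)"
    using e(2) ch(1) by (simp add: openin_open_eq)
  then have "openin (subtopology M (\<psi> ` V)) (\<psi> ` ball x e)"
    using homeomorphic_map_openness[OF ch(4)] e(2) by simp
  then have "openin M (\<psi> ` ball x e)"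
    using ch(2) by (rule openin_trans_full)
  moreover have "q \<in> \<psi> ` ball x e" using x e by simp
  moreover have "bounded_speed_joined M A F r s" if rs: "r \<in> \<psi> ` ball x e" "s \<in> \<psi> ` ball x e" for r s
  proof -
    obtain y z where yz: "r = \<psi> y" "s = \<psi> z" "y \<in> ball x e" "z \<in> ball x e"
      using rs by blast
    have "y + t *\<^sub>R (z - y) \<in> V" if "t \<in> {0..1}" for t
    proof -
      have "(1 - t) *\<^sub>R y + t *\<^sub>R z \<in> ball x e"
        using convexD_alt[OF convex_ball yz(3,4)] that by simp
      then show ?thesis using e(2) by (auto simp: algebra_simps)
    qed
    from bounded_speed_joined_chart_segment[OF M F c this] show ?thesis
      by (simp add: yz)
  qed
  ultimately show ?thesis by (rule that)
qed

text \<open>The set of points reachable from \<open>p\<close> is clopen, since a neighbourhood of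
  mutually joined points lies either inside it or outside it.\<close>

lemma bounded_speed_joined_connected:
  assumes M: "smooth_manifold M A" and F: "smooth_immersion A F" and "connected_space M"
    and p: "p \<in> topspace M" and q: "q \<in> topspace M"
  shows "bounded_speed_joined M A F p q"
proof -
  define R where "R = {r \<in> topspace M. bounded_speed_joined M A F p r}"
  have nbhd: "\<exists>N. openin M N \<and> r \<in> N \<and>
      (\<forall>s\<in>N. \<forall>s'\<in>N. bounded_speed_joined M A F s s')" if "r \<in> topspace M" for r
    using bounded_speed_joined_local[OF M F that] by metis
  have "openin M R"
  proof (subst openin_subopen, intro ballI)
    fix r assume r: "r \<in> R"
    then obtain N where "openin M N" "r \<in> N"
      and N: "\<forall>s\<in>N. \<forall>s'\<in>N. bounded_speed_joined M A F s s'"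
      using nbhd[of r] unfolding R_def by blast
    moreover have "N \<subseteq> R"
      using r N \<open>r \<in> N\<close> openin_subset[OF \<open>openin M N\<close>]
      by (auto simp: R_def intro: bounded_speed_joined_trans)
    ultimately show "\<exists>T. openin M T \<and> r \<in> T \<and> T \<subseteq> R" by blast
  qed
  moreover have "openin M (topspace M - R)"
  proof (subst openin_subopen, intro ballI)
    fix r assume r: "r \<in> topspace M - R"
    then obtain N where "openin M N" "r \<in> N"
      and N: "\<forall>s\<in>N. \<forall>s'\<in>N. bounded_speed_joined M A F s s'"
      using nbhd[of r] by blast
    moreover have "N \<subseteq> topspace M - R"
      using r N \<open>r \<in> N\<close> openin_subset[OF \<open>openin M N\<close>]
      by (auto simp: R_def intro: bounded_speed_joined_trans)
    ultimately show "\<exists>T. openin M T \<and> r \<in> T \<and> T \<subseteq> topspace M - R" by blast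
  qed
  moreover have "R \<subseteq> topspace M" by (auto simp: R_def)
  ultimately have "R = {} \<or> R = topspace M"
    using \<open>connected_space M\<close> unfolding connected_space_clopen_in closedin_def by blast
  moreover have "p \<in> R"
    using nbhd[OF p] p by (auto simp: R_def)
  ultimately show ?thesis using q by (auto simp: R_def)
qed

section \<open>Euclidean against geodesic distance, and the height at infinity\<close>

lemma dist_le_geodesic_dist:
  assumes M: "smooth_manifold M A" and F: "smooth_immersion A F" and "connected_space M"
    and "p \<in> topspace M" "q \<in> topspace M"
  shows "norm (F q - F p) \<le> geodesic_dist M A F p q"
proof -
  define I where "I = (INF \<gamma>\<in>{\<gamma>. piecewise_C1_curve M A \<gamma> \<and> \<gamma> 0 = p \<and> \<gamma> 1 = q}. curve_length F \<gamma>)"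
  obtain \<gamma> where \<gamma>: "piecewise_C1_curve M A \<gamma>" "\<gamma> 0 = p" "\<gamma> 1 = q" "curve_length F \<gamma> < \<infinity>"
    using bounded_speed_joined_curve_length[OF bounded_speed_joined_connected[OF assms]] by blast
  then have "I \<le> curve_length F \<gamma>"
    unfolding I_def by (intro INF_lower) simp
  \<comment> \<open>Finiteness is essential: \<open>enn2real\<close> sends \<open>top\<close> to 0,
    and it is monotone only below \<open>top\<close>.\<close>
  then have fin: "I < top" using \<gamma>(4) by (simp add: le_less_trans)
  have "ennreal (norm (F q - F p)) \<le> I"
    unfolding I_def using dist_le_curve_length[OF M F] by (intro INF_greatest) auto
  then have "enn2real (ennreal (norm (F q - F p))) \<le> enn2real I"
    using fin by (intro enn2real_mono)
  then show ?thesis by (simp add: geodesic_dist_def I_def)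
qed

theorem proposition2:
  fixes M :: "'m topology"
    and A :: "('n::finite, 'm) atlas"
    and F :: "'m \<Rightarrow> real^('n + 'k::finite)"
    and W :: "real^('n + 'k)"
    and X\<^sub>0 :: 'm
  assumes "norm W = 1"
    and "smooth_manifold M A" and "connected_space M"
    and "smooth_immersion A F"
    and "proper_map M euclidean F"
    and "Metric_space.mcomplete (topspace M) (geodesic_dist M A F)"
    and "translating_soliton W A F"
    and "X\<^sub>0 \<in> topspace M"
  shows "(\<forall>X\<in>topspace M. ereal (F X \<bullet> W) > (INF Y\<in>topspace M. ereal (F Y \<bullet> W))) \<and>
         (INF Y\<in>topspace M. ereal (F Y \<bullet> W)) =
           Liminf (inf (filtercomap (\<lambda>Y. geodesic_dist M A F Y X\<^sub>0) at_top) (principal (topspace M)))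
             (\<lambda>Y. ereal (F Y \<bullet> W))"
proof -
  define I where "I = (INF Y\<in>topspace M. ereal (F Y \<bullet> W))"
  \<comment> \<open>If the distances to \<open>X\<^sub>0\<close> were bounded, this filter would be
    trivial and the limit inferior would be \<infinity>. That case is excluded implicitly below,
    where the point \<open>Z\<close> lies outside \<open>K\<close> however large \<open>N\<close>
    is.\<close>
  define \<F> where "\<F> = inf (filtercomap (\<lambda>Y. geodesic_dist M A F Y X\<^sub>0) at_top) (principal (topspace M))"
  have lower: "\<exists>Y\<in>topspace M. F Y \<bullet> W < F X \<bullet> W" if X: "X \<in> topspace M" for X
  proof -
    obtain V \<psi> x where c: "(V, \<psi>) \<in> A" and x: "x \<in> V" "X = \<psi> x"
      using smooth_manifold_chartE[OF assms(2) X] .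
    obtain y where "y \<in> V" "F (\<psi> y) \<bullet> W < F X \<bullet> W"
      using translating_soliton_no_local_min[OF assms(1,7,4) c chart_homeomorphism(1)[OF assms(2) c] x(1)] x(2)
      by blast
    then show ?thesis
      using openin_subset[OF chart_homeomorphism(2)[OF assms(2) c]] by blast
  qed
  have strict: "I < ereal (F X \<bullet> W)" if "X \<in> topspace M" for X
    unfolding I_def INF_less_iff using lower[OF that] by simp
  have "I \<le> Liminf \<F> (\<lambda>Y. ereal (F Y \<bullet> W))"
  proof (rule Liminf_bounded)
    have "eventually (\<lambda>Y. Y \<in> topspace M) \<F>"
      by (simp add: \<F>_def eventually_inf_principal)
    then show "eventually (\<lambda>Y. I \<le> ereal (F Y \<bullet> W)) \<F>"
      by (rule eventually_mono) (use strict in \<open>auto intro: less_imp_le\<close>)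
  qed
  moreover have "Liminf \<F> (\<lambda>Y. ereal (F Y \<bullet> W)) \<le> I"
    unfolding Liminf_def
  proof (rule SUP_least, clarify)
    fix P assume "eventually P \<F>"
    then obtain N where N: "\<And>Y. N \<le> geodesic_dist M A F Y X\<^sub>0 \<Longrightarrow> Y \<in> topspace M \<Longrightarrow> P Y"
      unfolding \<F>_def eventually_inf_principal eventually_filtercomap_at_top_linorder by blast
    \<comment> \<open>The absolute value keeps \<open>X\<^sub>0\<close> in \<open>K\<close> when
      \<open>N\<close> is negative, so that a minimum over \<open>K\<close> exists. Points of
      \<open>M\<close> outside \<open>K\<close> have distance at least \<open>N\<close> from
      \<open>X\<^sub>0\<close> and therefore satisfy \<open>P\<close>.\<close>
    define K where "K = {Y. Y \<in> topspace M \<and> F Y \<in> cball (F X\<^sub>0) \<bar>N\<bar>}"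
    have "compactin M K"
      unfolding K_def by (rule compactin_proper_map_preimage[OF assms(5)]) simp
    then have "compact (F ` K)"
      using image_compactin[OF _ smooth_immersion_continuous_map[OF assms(2,4)]] by simp
    then have "compact ((\<lambda>z. z \<bullet> W) ` F ` K)"
      by (intro compact_continuous_image continuous_intros)
    then have "compact ((\<lambda>Y. F Y \<bullet> W) ` K)" by (simp add: image_image)
    moreover have "X\<^sub>0 \<in> K" using assms(8) by (simp add: K_def)
    ultimately obtain X\<^sub>1 where X\<^sub>1: "X\<^sub>1 \<in> K" "\<And>Y. Y \<in> K \<Longrightarrow> F X\<^sub>1 \<bullet> W \<le> F Y \<bullet> W"
      using compact_attains_inf[of "(\<lambda>Y. F Y \<bullet> W) ` K"] by blast
    \<comment> \<open>\<open>Z\<close> undercuts the minimum over \<open>K\<close>, so it lies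
      outside \<open>K\<close>, and its height bounds from below all heights on \<open>K\<close>.
      The infimum over \<open>P\<close> is thus below the heights inside \<open>K\<close> as
      well.\<close>
    obtain Z where Z: "Z \<in> topspace M" "F Z \<bullet> W < F X\<^sub>1 \<bullet> W"
      using lower X\<^sub>1(1) by (auto simp: K_def)
    have outside: "Inf ((\<lambda>Y. ereal (F Y \<bullet> W)) ` Collect P) \<le> ereal (F Y \<bullet> W)"
      if "Y \<in> topspace M" "Y \<notin> K" for Y
    proof (rule INF_lower)
      have "N \<le> norm (F X\<^sub>0 - F Y)"
        using that by (auto simp: K_def dist_norm)
      also have "\<dots> \<le> geodesic_dist M A F Y X\<^sub>0"
        using dist_le_geodesic_dist[OF assms(2,4,3) that(1) assms(8)] .
      finally show "Y \<in> Collect P" using N that(1) by simp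
    qed
    show "Inf ((\<lambda>Y. ereal (F Y \<bullet> W)) ` Collect P) \<le> I"
      unfolding I_def
    proof (rule INF_greatest)
      fix Y assume Y: "Y \<in> topspace M"
      show "Inf ((\<lambda>Y. ereal (F Y \<bullet> W)) ` Collect P) \<le> ereal (F Y \<bullet> W)"
      proof (cases "Y \<in> K")
        case True
        have "Z \<notin> K" using X\<^sub>1(2) Z(2) by force
        have "F Z \<bullet> W \<le> F Y \<bullet> W" using X\<^sub>1(2)[OF True] Z(2) by simp
        then show ?thesis
          using order_trans[OF outside[OF Z(1) \<open>Z \<notin> K\<close>]] by simp
      qed (use outside Y in blast)
    qed
  qed
  ultimately show ?thesis
    using strict unfolding I_def \<F>_def by (auto intro: antisym)
qed

end
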